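(* Let $\mathbf{K}$ be a field of characteristic $0$. Let $A$ be a $C_\infty$-algebra over $\mathbf{K}$, with operations $m_n^A$, let $B$ be a cochain complex over $\mathbf{K}$, and let $(f,g,H)$ be a contraction from $A$ (with differential $d_A=m_1^A$) to $B$. Then the transferred $A_\infty$-structure on $B$, given by $m_1^B=d_B$ and $m_n^B=\sum_{T\in\mathcal{T}_n} m_T$ for $n>1$ (the Kontsevich–Soibelman sum over planar trees), is a $C_\infty$-structure on $B$.
   Context: All multilinear maps on graded spaces are composed and tensored using the Koszul sign rule; $|a|$ denotes the degree of a homogeneous element $a$. Contraction. A contraction $(f,g,H)$ from a cochain complex $A$ to a cochain complex $B$ consists of cochain maps $f:A\to B$ and $g:B\to A$ of degree $0$ and a linear map $H:A\to A$ of degree $-1$ such that $f\circ g=1_B$ and $g\circ f-1_A=d_AH+Hd_A$. $A_\infty$-algebra (grading convention in which all operations have degree $1$). An $A_\infty$-algebra is a cochain complex $A$ with multilinear maps $m_n^A:A^{\otimes n}\to A$, $n\ge1$, of degree $1$, with $d=m_1^A$ and, for all $n\ge1$, $\sum_{k=1}^{n}\sum_{j=0}^{n-k} m_{n-k+1}^{A}\circ(1_A^{\otimes j}\otimes m_{k}^{A}\otimes 1_A^{\otimes n-j-k})=0$. Transferred structure. Let $\mathcal{T}_n$ be the set of isomorphism classes of rooted planar trees with $n$ tails, in which every vertex other than the tails and the root has at least two incoming edges (its valence is the number of incoming edges); the root is a terminal vertex with a single incoming edge. For $T\in\mathcal{T}_n$, the map $m_T:B^{\otimes n}\to B$ is obtained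 by assigning $g$ to each tail, $m_k^A$ to each vertex of valence $k\geq 2$, $H$ to each interior edge (an edge meeting neither a tail nor the root), and $f$ to the root, and composing these maps from the tails down to the root. Equivalently, define $G_1=g$ and, for $n>1$, $$G_n=\sum_{k=2}^n\sum_{n_1+\dots+n_k=n,\ n_i>0}H\circ m_k^A\circ(G_{n_1}\otimes\dots\otimes G_{n_k}),\qquad m_n^B=\sum_{k=2}^n\sum_{n_1+\dots+n_k=n,\ n_i>0}f\circ m_k^A\circ(G_{n_1}\otimes\dots\otimes G_{n_k}).$$ It is a known theorem of Kontsevich and Soibelman that these $m_n^B$ form an $A_\infty$-structure on $B$. Shuffle product. For a graded vector space $A$, let $TA=\bigoplus_{n\ge1}A^{\otimes n}$ and write $a_1\cdots a_n$ for $a_1\otimes\dots\otimes a_n$. The shuffle product $\sqcup\!\sqcup$ on $TA$ is $$a_1\cdots a_p\sqcup\!\sqcup a_{p+1}\cdots a_{p+q}=\sum_{I\sqcup J=\{1,\dots,p+q\},\ |I|=p,\ |J|=q}(-1)^{\varepsilon(I,J)}a_{\pi_1}\cdots a_{\pi_{p+q}},$$ where for $I=\{i_1<\dots<i_p\}$ and $J=\{j_1<\dots<j_q\}$ one sets $\pi_k=\ell$ if $i_\ell=k$ and $\pi_k=p+\ell$ if $j_\ell=k$, and $\varepsilon(I,J)=\sum_{i_k>j_l}|a_k|\,|a_{p+l}|$. For example $a_1a_2\sqcup\!\sqcup a_3=a_1a_2a_3+(-1)^{|a_2||a_3|}a_1a_3a_2+(-1)^{(|a_1|+|a_2|)|a_3|}a_3a_1a_2$.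 $C_\infty$-structure. A $C_\infty$-structure on a cochain complex $A$ is an $A_\infty$-structure such that for each $n>1$, $m_n^A$ vanishes on $A^{\otimes n}\cap(TA\sqcup\!\sqcup TA)$, where $TA\sqcup\!\sqcup TA$ is the linear span of all shuffle products of two elements of $TA$. *)

theory Defs
  imports Complex_Main "HOL-Library.Poly_Mapping"
begin

section \<open>Graded vector spaces, cochain complexes and contractions\<close>

text \<open>
  A graded vector space is the total space \<open>'a\<close> of an internal direct sum of the subspaces
  \<open>V i\<close>, \<open>i\<close> ranging over the integers.
\<close>

locale graded_vector_space = vector_space scale
  for scale :: "'k::field \<Rightarrow> 'a::ab_group_add \<Rightarrow> 'a" +
  fixes V :: "int \<Rightarrow> 'a set"
  assumes subspace_component: "\<And>i. subspace (V i)"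
    and direct_sum: "\<And>x. \<exists>!c :: int \<Rightarrow> 'a.
      finite {i. c i \<noteq> 0} \<and> (\<forall>i. c i \<in> V i) \<and> x = (\<Sum>i | c i \<noteq> 0. c i)"

definition homogeneous :: "(int \<Rightarrow> 'a set) \<Rightarrow> 'a \<Rightarrow> bool" where
  "homogeneous V a \<longleftrightarrow> (\<exists>i. a \<in> V i)"

text \<open>
  The zero vector lies in every component, so its degree is an unspecified integer; it only
  enters signs in front of terms that vanish.
\<close>

definition deg :: "(int \<Rightarrow> 'a set) \<Rightarrow> 'a \<Rightarrow> int" where
  "deg V a = (SOME i. a \<in> V i)"

definition koszul_sign :: "int \<Rightarrow> 'k::ring_1" where
  "koszul_sign e = (if even e then 1 else - 1)"

definition has_degree :: "(int \<Rightarrow> 'a set) \<Rightarrow> (int \<Rightarrow> 'b set) \<Rightarrow> int \<Rightarrow> ('a \<Rightarrow> 'b) \<Rightarrow> bool" where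
  "has_degree V W r \<phi> \<longleftrightarrow> (\<forall>i. \<forall>a \<in> V i. \<phi> a \<in> W (i + r))"

locale cochain_complex = graded_vector_space scale V
  for scale :: "'k::field \<Rightarrow> 'a::ab_group_add \<Rightarrow> 'a" and V :: "int \<Rightarrow> 'a set" +
  fixes d :: "'a \<Rightarrow> 'a"
  assumes d_linear: "Vector_Spaces.linear scale scale d"
    and d_degree: "has_degree V V 1 d"
    and d_square: "\<And>x. d (d x) = 0"

locale contraction =
  A: cochain_complex scaleA VA dA + B: cochain_complex scaleB VB dB
  for scaleA :: "'k::field \<Rightarrow> 'a::ab_group_add \<Rightarrow> 'a" and VA dA
    and scaleB :: "'k \<Rightarrow> 'b::ab_group_add \<Rightarrow> 'b" and VB dB +
  fixes f :: "'a \<Rightarrow> 'b" and g :: "'b \<Rightarrow> 'a" and H :: "'a \<Rightarrow> 'a"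
  assumes f_linear: "Vector_Spaces.linear scaleA scaleB f"
    and f_degree: "has_degree VA VB 0 f"
    and f_cochain: "\<And>x. f (dA x) = dB (f x)"
    and g_linear: "Vector_Spaces.linear scaleB scaleA g"
    and g_degree: "has_degree VB VA 0 g"
    and g_cochain: "\<And>y. g (dB y) = dA (g y)"
    and H_linear: "Vector_Spaces.linear scaleA scaleA H"
    and H_degree: "has_degree VA VA (- 1) H"
    and f_g: "\<And>y. f (g y) = y"
    and homotopy: "\<And>x. g (f x) - x = dA (H x) + H (dA x)"


section \<open>\<open>A\<^sub>\<infinity>\<close>-algebras\<close>

text \<open>
  A linear map on the \<open>n\<close>-fold tensor power is given by the corresponding multilinear map,
  a function on lists of length \<open>n\<close>; its values on lists of other lengths are irrelevant.
\<close>

definition multilinear ::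
  "('k::field \<Rightarrow> 'a::ab_group_add \<Rightarrow> 'a) \<Rightarrow> ('k \<Rightarrow> 'b::ab_group_add \<Rightarrow> 'b) \<Rightarrow> nat \<Rightarrow> ('a list \<Rightarrow> 'b) \<Rightarrow> bool" where
  "multilinear scale scale' n \<phi> \<longleftrightarrow>
    (\<forall>us vs. length us + 1 + length vs = n \<longrightarrow>
      Vector_Spaces.linear scale scale' (\<lambda>x. \<phi> (us @ [x] @ vs)))"

definition has_multidegree ::
  "(int \<Rightarrow> 'a set) \<Rightarrow> (int \<Rightarrow> 'b set) \<Rightarrow> nat \<Rightarrow> int \<Rightarrow> ('a list \<Rightarrow> 'b) \<Rightarrow> bool" where
  "has_multidegree V W n r \<phi> \<longleftrightarrow>
    (\<forall>as is. length as = n \<and> list_all2 (\<lambda>a i. a \<in> V i) as is \<longrightarrow> \<phi> as \<in> W (sum_list is + r))"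

text \<open>
  The Koszul rule gives the sign in
  \<open>(1\<^sup>\<otimes>\<^sup>j \<otimes> m\<^sub>k \<otimes> 1) (a\<^sub>1 \<otimes> \<dots> \<otimes> a\<^sub>n) = (-1)\<^bsup>\<bar>a\<^sub>1\<bar> + \<dots> + \<bar>a\<^sub>j\<bar>\<^esup> a\<^sub>1 \<otimes> \<dots> \<otimes> m\<^sub>k (a\<^sub>j\<^sub>+\<^sub>1, \<dots>) \<otimes> \<dots> \<otimes> a\<^sub>n\<close>,
  because \<open>m\<^sub>k\<close> has degree 1.  Homogeneous arguments suffice by multilinearity.
\<close>

locale A_infinity_algebra = cochain_complex scale V d
  for scale :: "'k::field \<Rightarrow> 'a::ab_group_add \<Rightarrow> 'a" and V d +
  fixes m :: "nat \<Rightarrow> 'a list \<Rightarrow> 'a"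
  assumes m_1: "\<And>x. m 1 [x] = d x"
    and m_multilinear: "\<And>n. n \<ge> 1 \<Longrightarrow> multilinear scale scale n (m n)"
    and m_degree: "\<And>n. n \<ge> 1 \<Longrightarrow> has_multidegree V V n 1 (m n)"
    and A_infinity_relation:
      "\<And>n as. n \<ge> 1 \<Longrightarrow> length as = n \<Longrightarrow> \<forall>a \<in> set as. homogeneous V a \<Longrightarrow>
        (\<Sum>k = 1..n. \<Sum>j = 0..n - k.
          scale (koszul_sign (\<Sum>a \<leftarrow> take j as. deg V a))
            (m (n - k + 1) (take j as @ [m k (take k (drop j as))] @ drop (j + k) as))) = 0"


section \<open>The tensor space and the shuffle product\<close>

text \<open>
  \<open>TA\<close> is the quotient of the space \<open>formal_tensors V\<close> of formal linear combinations of nonempty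
  words in homogeneous vectors by the subspace \<open>tensor_relations\<close>.  Subspaces of \<open>TA\<close> are
  represented by their preimages in \<open>formal_tensors V\<close>.
\<close>

definition formal_scale :: "'k::field \<Rightarrow> ('w \<Rightarrow>\<^sub>0 'k) \<Rightarrow> ('w \<Rightarrow>\<^sub>0 'k)" where
  "formal_scale c x = Poly_Mapping.map (\<lambda>y. c * y) x"

lemma lookup_formal_scale: "Poly_Mapping.lookup (formal_scale c x) w = c * Poly_Mapping.lookup x w"
  by (auto simp: formal_scale_def Poly_Mapping.map.rep_eq when_def)

lemma vector_space_formal_scale: "vector_space formal_scale"
  by unfold_locales
    (auto intro!: poly_mapping_eqI simp: lookup_formal_scale lookup_add algebra_simps)

definition formal_tensors :: "(int \<Rightarrow> 'a set) \<Rightarrow> ('a list \<Rightarrow>\<^sub>0 'k::field) set" where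
  "formal_tensors V = {x. \<forall>w \<in> Poly_Mapping.keys x. w \<noteq> [] \<and> (\<forall>a \<in> set w. homogeneous V a)}"

definition formal_tensor_power :: "(int \<Rightarrow> 'a set) \<Rightarrow> nat \<Rightarrow> ('a list \<Rightarrow>\<^sub>0 'k::field) set" where
  "formal_tensor_power V n = {x \<in> formal_tensors V. \<forall>w \<in> Poly_Mapping.keys x. length w = n}"

definition tensor_relations ::
  "('k::field \<Rightarrow> 'a::ab_group_add \<Rightarrow> 'a) \<Rightarrow> (int \<Rightarrow> 'a set) \<Rightarrow> ('a list \<Rightarrow>\<^sub>0 'k) set" where
  "tensor_relations scale V = module.span formal_scale
    ({Poly_Mapping.single (u @ [a + b] @ v) 1
        - Poly_Mapping.single (u @ [a] @ v) 1 - Poly_Mapping.single (u @ [b] @ v) 1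
      | u v a b. (\<forall>c \<in> set (u @ v). homogeneous V c) \<and> (\<exists>i. a \<in> V i \<and> b \<in> V i)} \<union>
     {Poly_Mapping.single (u @ [scale c a] @ v) 1 - Poly_Mapping.single (u @ [a] @ v) c
      | u v a c. \<forall>b \<in> set (u @ [a] @ v). homogeneous V b})"

text \<open>
  With positions counted from 0, a \<open>(p,q)\<close>-shuffle of \<open>u\<close> and \<open>v\<close> is given by the set \<open>I\<close> of the
  \<open>p\<close> positions that the letters of \<open>u\<close> take in the shuffled word.
\<close>

definition shuffle_word :: "'a list \<Rightarrow> 'a list \<Rightarrow> nat set \<Rightarrow> 'a list" where
  "shuffle_word u v I =
    map (\<lambda>k. if k \<in> I then u ! card (I \<inter> {..<k}) else v ! card ({..<k} - I))
      [0..<length u + length v]"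

text \<open>
  The exponent is summed over the pairs of a letter of \<open>u\<close> (at position \<open>i\<close>) and a letter
  of \<open>v\<close> (at position \<open>j\<close>) that end up in the opposite order.
\<close>

definition shuffle_exponent :: "(int \<Rightarrow> 'a set) \<Rightarrow> 'a list \<Rightarrow> 'a list \<Rightarrow> nat set \<Rightarrow> int" where
  "shuffle_exponent V u v I =
    (let w = shuffle_word u v I in
      \<Sum>(i, j) \<in> {(i, j). i \<in> I \<and> j \<in> {..<length u + length v} - I \<and> j < i}.
        deg V (w ! i) * deg V (w ! j))"

definition word_shuffle ::
  "(int \<Rightarrow> 'a set) \<Rightarrow> 'a list \<Rightarrow> 'a list \<Rightarrow> ('a list \<Rightarrow>\<^sub>0 'k::field)" where
  "word_shuffle V u v =
    (\<Sum>I | I \<subseteq> {..<length u + length v} \<and> card I = length u.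
      Poly_Mapping.single (shuffle_word u v I) (koszul_sign (shuffle_exponent V u v I)))"

definition shuffle_product ::
  "(int \<Rightarrow> 'a set) \<Rightarrow> ('a list \<Rightarrow>\<^sub>0 'k::field) \<Rightarrow> ('a list \<Rightarrow>\<^sub>0 'k) \<Rightarrow> ('a list \<Rightarrow>\<^sub>0 'k)" where
  "shuffle_product V x y =
    (\<Sum>u \<in> Poly_Mapping.keys x. \<Sum>v \<in> Poly_Mapping.keys y. formal_scale (Poly_Mapping.lookup x u * Poly_Mapping.lookup y v) (word_shuffle V u v))"

definition shuffle_span ::
  "('k::field \<Rightarrow> 'a::ab_group_add \<Rightarrow> 'a) \<Rightarrow> (int \<Rightarrow> 'a set) \<Rightarrow> ('a list \<Rightarrow>\<^sub>0 'k) set" where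
  "shuffle_span scale V = module.span formal_scale
    ({shuffle_product V x y | x y. x \<in> formal_tensors V \<and> y \<in> formal_tensors V}
      \<union> tensor_relations scale V)"

definition eval_formal ::
  "('k::field \<Rightarrow> 'b::ab_group_add \<Rightarrow> 'b) \<Rightarrow> ('a list \<Rightarrow> 'b) \<Rightarrow> ('a list \<Rightarrow>\<^sub>0 'k) \<Rightarrow> 'b" where
  "eval_formal scale \<phi> x = (\<Sum>w \<in> Poly_Mapping.keys x. scale (Poly_Mapping.lookup x w) (\<phi> w))"

locale C_infinity_algebra = A_infinity_algebra scale V d m
  for scale :: "'k::field \<Rightarrow> 'a::ab_group_add \<Rightarrow> 'a" and V d m +
  assumes vanishes_on_shuffles:
    "\<And>n x. n > 1 \<Longrightarrow> x \<in> formal_tensor_power V n \<inter> shuffle_span scale V \<Longrightarrow>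
      eval_formal scale (m n) x = 0"


section \<open>The transferred structure\<close>

text \<open>
  \<open>Tail\<close> is a tail and \<open>Vertex ts\<close> a vertex whose incoming edges carry the subtrees \<open>ts\<close>, in
  planar order.  The terminal root vertex with its single incoming edge is left implicit.
\<close>

datatype planar_tree = Tail | Vertex "planar_tree list"

fun num_tails :: "planar_tree \<Rightarrow> nat" where
  "num_tails Tail = 1"
| "num_tails (Vertex ts) = (\<Sum>t \<leftarrow> ts. num_tails t)"

fun reduced :: "planar_tree \<Rightarrow> bool" where
  "reduced Tail \<longleftrightarrow> True"
| "reduced (Vertex ts) \<longleftrightarrow> length ts \<ge> 2 \<and> (\<forall>t \<in> set ts. reduced t)"

definition planar_trees :: "nat \<Rightarrow> planar_tree set" where
  "planar_trees n = {T. reduced T \<and> num_tails T = n}"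

text \<open>
  \<open>subtree_map m g H t\<close> is the map assigned to a subtree \<open>t\<close> hanging off a vertex: \<open>g\<close> for a
  tail, and otherwise the operation of its lowest vertex followed by \<open>H\<close> for the interior edge
  below it.  It has degree 0, so that no Koszul signs occur in the tensor product of such maps,
  which is computed by \<open>forest_map\<close>.
\<close>

fun subtree_map ::
    "(nat \<Rightarrow> 'a list \<Rightarrow> 'a) \<Rightarrow> ('b \<Rightarrow> 'a) \<Rightarrow> ('a \<Rightarrow> 'a) \<Rightarrow> planar_tree \<Rightarrow> 'b list \<Rightarrow> 'a"
  and forest_map ::
    "(nat \<Rightarrow> 'a list \<Rightarrow> 'a) \<Rightarrow> ('b \<Rightarrow> 'a) \<Rightarrow> ('a \<Rightarrow> 'a) \<Rightarrow> planar_tree list \<Rightarrow> 'b list \<Rightarrow> 'a list"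
where
  "subtree_map m g H Tail bs = g (hd bs)"
| "subtree_map m g H (Vertex ts) bs = H (m (length ts) (forest_map m g H ts bs))"
| "forest_map m g H [] bs = []"
| "forest_map m g H (t # ts) bs =
    subtree_map m g H t (take (num_tails t) bs) # forest_map m g H ts (drop (num_tails t) bs)"

fun tree_operation ::
  "(nat \<Rightarrow> 'a list \<Rightarrow> 'a) \<Rightarrow> ('a \<Rightarrow> 'b) \<Rightarrow> ('b \<Rightarrow> 'a) \<Rightarrow> ('a \<Rightarrow> 'a) \<Rightarrow> planar_tree \<Rightarrow> 'b list \<Rightarrow> 'b"
where
  "tree_operation m f g H Tail bs = f (g (hd bs))"
| "tree_operation m f g H (Vertex ts) bs = f (m (length ts) (forest_map m g H ts bs))"

definition transferred ::
  "(nat \<Rightarrow> 'a list \<Rightarrow> 'a) \<Rightarrow> ('b \<Rightarrow> 'b) \<Rightarrow> ('a \<Rightarrow> 'b) \<Rightarrow> ('b \<Rightarrow> 'a) \<Rightarrow> ('a \<Rightarrow> 'a) \<Rightarrow>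
    nat \<Rightarrow> 'b list \<Rightarrow> 'b::ab_group_add" where
  "transferred m dB f g H n bs =
    (if n = 1 then dB (hd bs) else \<Sum>T \<in> planar_trees n. tree_operation m f g H T bs)"

lemma num_tails_pos: "reduced T \<Longrightarrow> num_tails T > 0"
proof (induction T)
  case (Vertex ts)
  then obtain t us where "ts = t # us" by (cases ts) auto
  with Vertex show ?case by auto
qed simp

lemma finite_planar_trees: "finite (planar_trees n)"
proof (induction n rule: less_induct)
  case (less n)
  define S where "S = (\<Union>k<n. planar_trees k)"
  have fin: "finite S" unfolding S_def using less by auto
  have "T \<in> insert Tail (Vertex ` {ts. set ts \<subseteq> S \<and> length ts \<le> n})"
    if T: "T \<in> planar_trees n" for T
  proof (cases T)
    case (Vertex ts)
    have pos: "\<forall>t \<in> set ts. num_tails t \<ge> 1"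
      using T Vertex num_tails_pos by (fastforce simp: planar_trees_def)
    have sum: "n = (\<Sum>t \<leftarrow> ts. num_tails t)" "length ts \<ge> 2"
      using T Vertex by (auto simp: planar_trees_def)
    have len: "length us \<le> (\<Sum>t \<leftarrow> us. num_tails t)" if "set us \<subseteq> set ts" for us
      using that pos by (induction us) force+
    have "num_tails t < n" if "t \<in> set ts" for t
    proof -
      obtain us vs where ts: "ts = us @ t # vs" using \<open>t \<in> set ts\<close> by (meson split_list)
      have "length us \<le> (\<Sum>t \<leftarrow> us. num_tails t)" "length vs \<le> (\<Sum>t \<leftarrow> vs. num_tails t)"
        by (rule len; auto simp: ts)+
      then show ?thesis using sum unfolding ts map_append sum_list_append length_append list.map
          sum_list.Cons list.size by linarith
    qed
    then have "set ts \<subseteq> S" using T Vertex by (auto simp: S_def planar_trees_def)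
    with len[of ts] sum Vertex show ?thesis by auto
  qed simp
  then have "planar_trees n \<subseteq> insert Tail (Vertex ` {ts. set ts \<subseteq> S \<and> length ts \<le> n})" by blast
  then show ?case by (rule finite_subset) (use finite_lists_length_le[OF fin] in auto)
qed

end

theory Submission
  imports Defs
begin

text \<open>
  Write \<open>G\<close> for the sum of the subtree maps over all trees (\<open>tree_sum\<close>) and \<open>P\<close> for the same sum over
  trees with at least one vertex, without the final \<open>H\<close> (\<open>vertex_sum\<close>).  Then \<open>G = g + H P\<close>,
  \<open>m\<^sup>B = d\<^sub>B + f P\<close>, and \<open>P\<close> is obtained by cutting a word into at least two blocks, applying \<open>G\<close> to each
  block and then an operation of \<open>A\<close>.  In coalgebra language \<open>G\<close> is the corestriction of a coalgebra
  morphism \<open>\<Gamma> : TB \<rightarrow> TA\<close>, the operations of \<open>A\<close> and \<open>B\<close> are corestrictions of coderivations, and \<open>P\<close>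
  is the part of \<open>m\<^sup>A \<circ> \<Gamma>\<close> that comes from operations of valence at least two.

  The \<open>A\<^sub>\<infinity>\<close>-relations of \<open>B\<close> follow from \<open>d\<^sub>A P + P \<circ> m\<^sup>B = 0\<close> (\<open>vertex_sum_relation\<close>), with \<open>m\<^sup>B\<close> inserted as a
  coderivation.  This is proved together with the morphism equation \<open>d\<^sub>A G + P = G \<circ> m\<^sup>B\<close>
  (\<open>tree_sum_morphism\<close>) by induction on the length of the word.  The \<open>A\<^sub>\<infinity>\<close>-relations of \<open>A\<close>, applied to
  the image of \<open>\<Gamma>\<close>, express \<open>d\<^sub>A P\<close> by terms in which one block carries \<open>d\<^sub>A G + P\<close>; by induction that
  block carries \<open>G \<circ> m\<^sup>B\<close>, and the terms assemble to \<open>- P \<circ> m\<^sup>B\<close>.  The homotopy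
  formula \<open>g f - 1 = d\<^sub>A H + H d\<^sub>A\<close> then gives the morphism equation for the same word.

  For the \<open>C\<^sub>\<infinity>\<close>-property it suffices that \<open>P\<close> vanishes on shuffles (\<open>vertex_sum_shuffle\<close>), again by
  induction on the length.  The deconcatenation coproduct is multiplicative for the shuffle product
  (\<open>shuffle_sum_split_sum\<close>).  Hence cutting a shuffle of \<open>u\<close> and \<open>v\<close> into blocks produces blocks that are
  themselves shuffles of a piece of \<open>u\<close> and a piece of \<open>v\<close>.  In \<open>P\<close> there are at least two blocks, all
  shorter than the word, and by induction \<open>G\<close> annihilates such a block unless one of the two pieces
  is empty, so that up to the cut into a single block \<open>\<Gamma>\<close> carries the shuffle of \<open>u\<close> and \<open>v\<close> to the shuffle
  of their images (\<open>shuffle_sum_block_sum\<close>), on which the operations of \<open>A\<close> vanish.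

  Two encodings make this argument elementary.  Letters are pairs of a vector and a degree, because
  the degree of a vector is ambiguous when an intermediate result is zero; a word with a
  zero letter contributes zero whatever its sign.  Elements of tensor coalgebras never appear: a linear map into
  \<open>TA\<close> is represented by its effect on the functions \<open>\<phi>\<close> that may be evaluated on words afterwards, so
  that the identities between morphisms, coderivations and shuffles become inductions over lists.
\<close>

section \<open>Signs and additive functionals\<close>

definition signed :: "int \<Rightarrow> 'c::ab_group_add \<Rightarrow> 'c" where
  "signed e x = (if even e then x else - x)"

lemma signed_0_left [simp]: "signed 0 x = x"
  and signed_zero [simp]: "signed e 0 = 0"
  and signed_add: "signed e (x + y) = signed e x + signed e y"
  and signed_signed [simp]: "signed e (signed e' x) = signed (e + e') x"
  by (auto simp: signed_def)

lemma additive_signed: "additive (signed e)"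
  by (simp add: additive_def signed_add)

lemma (in additive) signed: "f (signed e x) = signed e (f x)"
  by (simp add: signed_def minus)

text \<open>
  All the sums over words used here are additive in the summand as a function; this is what allows
  two of them to be interchanged.
\<close>

definition additive_functional :: "(('z \<Rightarrow> 'c::ab_group_add) \<Rightarrow> 'c) \<Rightarrow> bool" where
  "additive_functional \<Phi> \<longleftrightarrow> (\<forall>A B. \<Phi> (\<lambda>z. A z + B z) = \<Phi> A + \<Phi> B)"

lemma additive_functionalD:
  "additive_functional \<Phi> \<Longrightarrow> \<Phi> (\<lambda>z. A z + B z) = \<Phi> A + \<Phi> B"
  by (simp add: additive_functional_def)

lemma additive_functional_zero:
  assumes "additive_functional \<Phi>"
  shows "\<Phi> (\<lambda>z. 0) = 0"
  using additive_functionalD[OF assms, of "\<lambda>z. 0" "\<lambda>z. 0"] by simp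

lemma additive_functional_signed:
  assumes "additive_functional \<Phi>"
  shows "\<Phi> (\<lambda>z. signed e (A z)) = signed e (\<Phi> A)"
proof -
  have "\<Phi> (\<lambda>z. - A z) + \<Phi> A = 0"
    using additive_functionalD[OF assms, of "\<lambda>z. - A z" A] additive_functional_zero[OF assms] by simp
  then have "\<Phi> (\<lambda>z. - A z) = - \<Phi> A" by (simp add: eq_neg_iff_add_eq_0)
  then show ?thesis by (simp add: signed_def)
qed

section \<open>Deconcatenation and cutting into blocks\<close>

text \<open>
  \<open>F\<close> composed with the deconcatenation coproduct, counital terms included.
\<close>

fun split_sum :: "('x list \<Rightarrow> 'x list \<Rightarrow> 'c::ab_group_add) \<Rightarrow> 'x list \<Rightarrow> 'c" where
  "split_sum F [] = F [] []"
| "split_sum F (a # w) = F [] (a # w) + split_sum (\<lambda>x. F (a # x)) w"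

lemma split_sum_cong [fundef_cong]:
  assumes "w = w'" "\<And>x y. x @ y = w' \<Longrightarrow> F x y = F' x y"
  shows "split_sum F w = split_sum F' w'"
  unfolding assms(1) using assms(2)
proof (induction w' arbitrary: F F')
  case (Cons a w)
  have "split_sum (\<lambda>x. F (a # x)) w = split_sum (\<lambda>x. F' (a # x)) w"
    by (rule Cons.IH) (simp add: Cons.prems)
  then show ?case using Cons.prems by simp
qed simp

lemma split_sum_add: "split_sum (\<lambda>x y. F x y + F' x y) w = split_sum F w + split_sum F' w"
  by (induction w arbitrary: F F') (simp_all add: algebra_simps)

lemma split_sum_functional:
  "additive_functional \<Phi> \<Longrightarrow> split_sum (\<lambda>x y. \<Phi> (\<lambda>z. F z x y)) w = \<Phi> (\<lambda>z. split_sum (F z) w)"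
  by (induction w arbitrary: F) (simp_all add: additive_functionalD[of \<Phi>])

lemma split_sum_additive: "additive h \<Longrightarrow> split_sum (\<lambda>x y. h (F x y)) w = h (split_sum F w)"
  by (induction w arbitrary: F) (simp_all add: additive.add[of h])

lemma split_sum_signed: "split_sum (\<lambda>x y. signed e (F x y)) w = signed e (split_sum F w)"
  by (rule split_sum_additive[OF additive_signed])

lemma split_sum_zero: "(\<And>x y. x @ y = w \<Longrightarrow> F x y = 0) \<Longrightarrow> split_sum F w = 0"
  by (induction w arbitrary: F) auto

lemma split_sum_left_Nil: "split_sum (\<lambda>x y. if x = [] then F y else 0) w = F w"
  by (cases w) (auto intro: split_sum_zero)

lemma split_sum_right_Nil: "split_sum (\<lambda>x y. if y = [] then F x else 0) w = F w"
  by (induction w arbitrary: F) auto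

text \<open>
  Coassociativity of deconcatenation.
\<close>

lemma split_sum_assoc:
  "split_sum (\<lambda>x y. split_sum (\<lambda>y z. F x y z) y) w = split_sum (\<lambda>x z. split_sum (\<lambda>x y. F x y z) x) w"
  by (induction w arbitrary: F) (simp_all add: split_sum_add algebra_simps)

lemma split_sum_eq_sum: "split_sum F w = (\<Sum>i\<le>length w. F (take i w) (drop i w))"
  by (induction w arbitrary: F) (simp_all add: sum.atMost_Suc_shift del: sum.atMost_Suc)

text \<open>
  \<open>\<phi>\<close> composed with the coalgebra morphism of tensor coalgebras with corestriction \<open>G\<close>: the sum
  runs over all ways of cutting the word into nonempty blocks.
\<close>

fun block_sum :: "('x list \<Rightarrow> 'y) \<Rightarrow> ('y list \<Rightarrow> 'c::ab_group_add) \<Rightarrow> 'x list \<Rightarrow> 'c" where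
  "block_sum G \<phi> [] = \<phi> []"
| "block_sum G \<phi> (a # w) = split_sum (\<lambda>x y. block_sum G (\<lambda>r. \<phi> (G (a # x) # r)) y) w"

lemma block_sum_add:
  "block_sum G (\<lambda>r. \<phi> r + \<psi> r) w = block_sum G \<phi> w + block_sum G \<psi> w"
proof (induction G \<phi> w arbitrary: \<psi> rule: block_sum.induct)
  case (2 G \<phi> a w)
  then show ?case by (simp add: split_sum_add cong: split_sum_cong)
qed simp

lemma additive_functional_block_sum: "additive_functional (\<lambda>\<phi>. block_sum G \<phi> w)"
  by (simp add: additive_functional_def block_sum_add)

lemma block_sum_additive: "additive h \<Longrightarrow> block_sum G (\<lambda>r. h (\<phi> r)) w = h (block_sum G \<phi> w)"
proof (induction G \<phi> w rule: block_sum.induct)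
  case (2 G \<phi> a w)
  then show ?case by (simp add: split_sum_additive[of h, symmetric] cong: split_sum_cong)
qed simp

text \<open>
  The conditions on \<open>r\<close> record all that is known of a word of block values: its length,
  whether it is empty, and that its letters are values of \<open>G\<close> on nonempty pieces of \<open>w\<close>.
\<close>

lemma block_sum_cong:
  assumes "\<And>r. length r \<le> length w \<Longrightarrow> (r = [] \<longleftrightarrow> w = []) \<Longrightarrow>
      (\<And>c. c \<in> set r \<Longrightarrow> \<exists>x. x \<noteq> [] \<and> set x \<subseteq> set w \<and> c = G x) \<Longrightarrow> \<phi> r = \<psi> r"
  shows "block_sum G \<phi> w = block_sum G \<psi> w"
  using assms
proof (induction G \<phi> w arbitrary: \<psi> rule: block_sum.induct)
  case (2 G \<phi> a w)
  show ?case unfolding block_sum.simps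
  proof (rule split_sum_cong[OF refl], rule 2(1))
    fix x y r
    assume *: "x @ y = w" "length r \<le> length y" "r = [] \<longleftrightarrow> y = []"
      "\<And>c. c \<in> set r \<Longrightarrow> \<exists>x. x \<noteq> [] \<and> set x \<subseteq> set y \<and> c = G x"
    show "\<phi> (G (a # x) # r) = \<psi> (G (a # x) # r)"
    proof (rule 2(2), goal_cases)
      case (3 c)
      then show ?case using * by fastforce
    qed (use * in auto)
  qed auto
qed auto

text \<open>
  \<open>block_sum G\<close> is a coalgebra morphism: a cut of the word of blocks is a cut of the original
  word at the end of a block.
\<close>

lemma block_sum_split_sum:
  "block_sum G (split_sum F) w = split_sum (\<lambda>x y. block_sum G (\<lambda>s. block_sum G (F s) y) x) w"
proof (induction "length w" arbitrary: w F rule: less_induct)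
  case less
  show ?case
  proof (cases w)
    case (Cons a w')
    have "block_sum G (split_sum F) w =
        block_sum G (F []) w + split_sum (\<lambda>x y. block_sum G (split_sum (\<lambda>s. F (G (a # x) # s))) y) w'"
      by (simp add: Cons block_sum_add flip: split_sum_add cong: split_sum_cong)
    also have "split_sum (\<lambda>x y. block_sum G (split_sum (\<lambda>s. F (G (a # x) # s))) y) w'
      = split_sum (\<lambda>x y. split_sum (\<lambda>y z. block_sum G (\<lambda>s. block_sum G (F (G (a # x) # s)) z) y) y) w'"
      by (rule split_sum_cong[OF refl], rule less) (auto simp: Cons)
    finally show ?thesis by (simp add: Cons split_sum_assoc)
  qed simp
qed

section \<open>Coderivations\<close>

definition word_degree :: "('a \<times> int) list \<Rightarrow> int" where
  "word_degree w = (\<Sum>a\<leftarrow>w. snd a)"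

lemma word_degree_simps [simp]:
  "word_degree [] = 0"
  "word_degree (a # w) = snd a + word_degree w"
  "word_degree (u @ v) = word_degree u + word_degree v"
  by (simp_all add: word_degree_def)

text \<open>
  Additivity in every tensor factor.  Letting the three degrees differ makes \<open>\<phi>\<close> independent of the
  degrees attached to its arguments, so they only serve to compute signs.
\<close>

definition slot_additive :: "(('a::ab_group_add \<times> int) list \<Rightarrow> 'c::ab_group_add) \<Rightarrow> bool" where
  "slot_additive \<phi> \<longleftrightarrow>
    (\<forall>p s x y i j k. \<phi> (p @ (x + y, i) # s) = \<phi> (p @ (x, j) # s) + \<phi> (p @ (y, k) # s))"

lemma slot_additive_Cons: "slot_additive \<phi> \<Longrightarrow> slot_additive (\<lambda>r. \<phi> (c # r))"
  unfolding slot_additive_def by (metis append_Cons)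

lemma slot_additive_zero: "slot_additive \<phi> \<Longrightarrow> \<phi> (p @ (0, i) # s) = 0"
  unfolding slot_additive_def by (metis add.right_neutral add_cancel_right_right)

lemma slot_additive_degree: "slot_additive \<phi> \<Longrightarrow> \<phi> (p @ (x, i) # s) = \<phi> (p @ (x, j) # s)"
  using slot_additive_zero[of \<phi> p 0 s] unfolding slot_additive_def
  by (metis add.right_neutral)

lemma slot_additive_additive: "slot_additive \<phi> \<Longrightarrow> additive (\<lambda>x. \<phi> (p @ (x, i) # s))"
  unfolding slot_additive_def additive_def by blast

lemma slot_additive_hd:
  assumes "slot_additive \<phi>"
  shows "additive (\<lambda>x. block_sum G (\<lambda>r. \<phi> ((x, 0) # r)) w)"
    and "block_sum G (\<lambda>r. \<phi> (c # r)) w = block_sum G (\<lambda>r. \<phi> ((fst c, 0) # r)) w"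
proof -
  show "additive (\<lambda>x. block_sum G (\<lambda>r. \<phi> ((x, 0) # r)) w)"
    using assms[unfolded slot_additive_def, rule_format, of "[]"]
    by (auto simp: additive_def block_sum_add[symmetric] intro!: block_sum_cong)
  show "block_sum G (\<lambda>r. \<phi> (c # r)) w = block_sum G (\<lambda>r. \<phi> ((fst c, 0) # r)) w"
    using slot_additive_degree[OF assms, of "[]" "fst c" "snd c" _ 0] by simp
qed

text \<open>
  \<open>\<phi>\<close> composed with the coderivation with corestriction \<open>M\<close> of degree 1: one nonempty piece of the
  word is replaced by its value under \<open>M\<close>, with the Koszul sign of moving \<open>M\<close> past the letters
  before it.
\<close>

fun insertion_sum ::
  "(('a \<times> int) list \<Rightarrow> 'a \<times> int) \<Rightarrow> (('a \<times> int) list \<Rightarrow> 'c::ab_group_add) \<Rightarrow> ('a \<times> int) list \<Rightarrow> 'c"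
where
  "insertion_sum M \<phi> [] = 0"
| "insertion_sum M \<phi> (a # w) = split_sum (\<lambda>y z. \<phi> (M (a # y) # z)) w
    + signed (snd a) (insertion_sum M (\<lambda>r. \<phi> (a # r)) w)"

text \<open>
  Cuts the word into blocks and applies \<open>K\<close>, of degree 1, to one of them and \<open>G\<close> to all the others.
  Both composites of the coalgebra morphism of \<open>G\<close> with a coderivation have this form.
\<close>

fun block_insertion_sum ::
  "(('b \<times> int) list \<Rightarrow> 'y) \<Rightarrow> (('b \<times> int) list \<Rightarrow> 'y) \<Rightarrow> ('y list \<Rightarrow> 'c::ab_group_add)
    \<Rightarrow> ('b \<times> int) list \<Rightarrow> 'c"
where
  "block_insertion_sum G K \<phi> [] = 0"
| "block_insertion_sum G K \<phi> (a # w) = split_sum (\<lambda>x y.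
      block_sum G (\<lambda>r. \<phi> (K (a # x) # r)) y
      + signed (word_degree (a # x)) (block_insertion_sum G K (\<lambda>r. \<phi> (G (a # x) # r)) y)) w"

lemma insertion_sum_add:
  "insertion_sum M (\<lambda>r. \<phi> r + \<psi> r) w = insertion_sum M \<phi> w + insertion_sum M \<psi> w"
  by (induction w arbitrary: \<phi> \<psi>) (simp_all add: split_sum_add signed_add)

lemma insertion_sum_additive:
  assumes "additive h"
  shows "insertion_sum M (\<lambda>r. h (\<phi> r)) w = h (insertion_sum M \<phi> w)"
  by (induction w arbitrary: \<phi>)
    (simp_all add: additive.zero[OF assms] additive.add[OF assms] additive.signed[OF assms]
      split_sum_additive[OF assms])

text \<open>
  The coderivation property of \<open>insertion_sum\<close>.  A piece that straddles the cut
  does not occur, since it is replaced by a single letter before the word is cut.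
\<close>

lemma insertion_sum_split_sum:
  "insertion_sum M (split_sum F) w = split_sum (\<lambda>x y.
    insertion_sum M (\<lambda>r. F r y) x + signed (word_degree x) (insertion_sum M (F x) y)) w"
proof (induction w arbitrary: F)
  case (Cons a w)
  then show ?case
    by (simp add: insertion_sum_add split_sum_add split_sum_signed signed_add split_sum_assoc
        ac_simps flip: split_sum_signed)
qed simp

text \<open>
  The corestriction of a coderivation is recovered by projecting to words of length one.
\<close>

lemma insertion_sum_single:
  assumes "w \<noteq> []"
  shows "insertion_sum M (\<lambda>r. if length r = 1 then h (hd r) else 0) w = h (M w)"
proof -
  obtain a v where w: "w = a # v" using assms by (cases w) auto
  have zero: "insertion_sum M (\<lambda>r. if r = [] then h c else 0) v = 0" for c
    by (cases v) (auto intro!: split_sum_zero simp: insertion_sum_additive[of "\<lambda>_. 0"] additive_def)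
  have "insertion_sum M (\<lambda>r. if length r = 1 then h (hd r) else 0) w =
    split_sum (\<lambda>y z. if z = [] then h (M (a # y)) else 0) v"
    using zero[of a] by (simp add: w if_distrib cong: if_cong)
  then show ?thesis by (simp add: split_sum_right_Nil w)
qed

lemma block_insertion_sum_add:
  "block_insertion_sum G K (\<lambda>r. \<phi> r + \<psi> r) w
    = block_insertion_sum G K \<phi> w + block_insertion_sum G K \<psi> w"
proof (induction G K \<phi> w arbitrary: \<psi> rule: block_insertion_sum.induct)
  case (2 G K \<phi> a w)
  show ?case unfolding block_insertion_sum.simps split_sum_add[symmetric]
    by (rule split_sum_cong[OF refl]) (simp only: 2 block_sum_add signed_add ac_simps)
qed simp

text \<open>
  The bound on lengths matters: as soon as \<open>p\<close> or \<open>s\<close> is nonempty, \<open>x\<close> is shorter than \<open>w\<close>, which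
  gives access to an induction hypothesis.
\<close>

lemma block_insertion_sum_cong:
  assumes "\<And>p x s. x \<noteq> [] \<Longrightarrow> set x \<subseteq> set w \<Longrightarrow> length p + length x + length s \<le> length w \<Longrightarrow>
    \<phi> (p @ K x # s) = \<psi> (p @ K' x # s)"
  shows "block_insertion_sum G K \<phi> w = block_insertion_sum G K' \<psi> w"
  using assms
proof (induction G K \<phi> w arbitrary: \<psi> rule: block_insertion_sum.induct)
  case (2 G K \<phi> a w)
  show ?case unfolding block_insertion_sum.simps
  proof (rule split_sum_cong[OF refl], rule arg_cong2[of _ _ _ _ "(+)"])
    fix x y assume xy: "x @ y = w"
    have "\<phi> ([] @ K (a # x) # r) = \<psi> ([] @ K' (a # x) # r)" if "length r \<le> length y" for r
      by (rule 2(2)) (use that xy in auto)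
    then show "block_sum G (\<lambda>r. \<phi> (K (a # x) # r)) y = block_sum G (\<lambda>r. \<psi> (K' (a # x) # r)) y"
      by (auto intro: block_sum_cong)
    have "block_insertion_sum G K (\<lambda>r. \<phi> (G (a # x) # r)) y
        = block_insertion_sum G K' (\<lambda>r. \<psi> (G (a # x) # r)) y"
    proof (rule 2(1)[OF xy], goal_cases)
      case (1 z p s)
      then have "\<phi> ((G (a # x) # p) @ K z # s) = \<psi> ((G (a # x) # p) @ K' z # s)"
        by (intro 2(2)) (use xy in auto)
      then show ?case by simp
    qed
    then show "signed (word_degree (a # x)) (block_insertion_sum G K (\<lambda>r. \<phi> (G (a # x) # r)) y)
        = signed (word_degree (a # x)) (block_insertion_sum G K' (\<lambda>r. \<psi> (G (a # x) # r)) y)" by simp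
  qed
qed simp

lemma block_sum_single:
  assumes "w \<noteq> []"
  shows "block_sum G (\<lambda>r. if length r = 1 then h (hd r) else 0) w = h (G w)"
proof -
  obtain a v where w: "w = a # v" using assms by (cases w) auto
  have "block_sum G (\<lambda>r. if r = [] then h c else 0) y = (if y = [] then h c else 0)" for c y
    using additive_functional_zero[OF additive_functional_block_sum]
    by (cases y) (auto intro!: split_sum_zero)
  then have "block_sum G (\<lambda>r. if length r = 1 then h (hd r) else 0) w =
      split_sum (\<lambda>x y. if y = [] then h (G (a # x)) else 0) v"
    by (simp add: w cong: if_cong split_sum_cong)
  then show ?thesis by (simp add: split_sum_right_Nil w)
qed

lemma block_insertion_sum_single:
  assumes "w \<noteq> []"
  shows "block_insertion_sum G K (\<lambda>r. if length r = 1 then h (hd r) else 0) w = h (K w)"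
proof -
  have zero: "block_insertion_sum G K (\<lambda>r. 0) y = 0" for y
    using block_insertion_sum_add[of G K "\<lambda>_. 0" "\<lambda>_. 0" y] by simp
  obtain a v where w: "w = a # v" using assms by (cases w) auto
  have "block_sum G (\<lambda>r. if r = [] then h c else 0) y = (if y = [] then h c else 0)" for c y
    using additive_functional_zero[OF additive_functional_block_sum]
    by (cases y) (auto intro!: split_sum_zero)
  moreover have "block_insertion_sum G K (\<lambda>r. if r = [] then h c else 0) y = 0" for c y
    by (rule trans[OF block_insertion_sum_cong[of y _ K "\<lambda>r. 0" K G] zero]) simp
  ultimately have "block_insertion_sum G K (\<lambda>r. if length r = 1 then h (hd r) else 0) w =
      split_sum (\<lambda>x y. if y = [] then h (K (a # x)) else 0) v"
    by (simp add: w cong: if_cong split_sum_cong)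
  then show ?thesis by (simp add: split_sum_right_Nil w)
qed

text \<open>
  A coderivation followed by the coalgebra morphism: the inserted letter lies in one of the
  blocks, and collecting its possible positions inside that block gives \<open>G\<close> applied after an
  insertion.  The degree \<open>k x\<close> given to this value is arbitrary by slot additivity.
\<close>

lemma insertion_sum_block_sum:
  assumes "slot_additive \<phi>"
  shows "insertion_sum M (block_sum G \<phi>) w =
    block_insertion_sum G (\<lambda>x. (insertion_sum M (\<lambda>r. fst (G r)) x, k x)) \<phi> w"
  using assms
proof (induction "length w" arbitrary: w \<phi> rule: less_induct)
  case less
  show ?case
  proof (cases w)
    case (Cons a v)
    \<comment> \<open>The degree 0 in \<open>h\<close> is a dummy, by slot additivity.\<close>
    define h where "h y c = block_sum G (\<lambda>r. \<phi> ((c, 0) # r)) y" for y c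
    have h: "additive (h y)" "block_sum G (\<lambda>r. \<phi> (c # r)) y = h y (fst c)" for y c
      unfolding h_def using slot_additive_hd[OF less(2)] by blast+
    have "insertion_sum M (block_sum G \<phi>) w =
        split_sum (\<lambda>y z. split_sum (\<lambda>z1 z2. h z2 (fst (G (M (a # y) # z1)))) z) v
        + signed (snd a) (insertion_sum M (split_sum (\<lambda>x. block_sum G (\<lambda>r. \<phi> (G (a # x) # r)))) v)"
      by (simp add: Cons h(2)[symmetric])
    also have "split_sum (\<lambda>y z. split_sum (\<lambda>z1 z2. h z2 (fst (G (M (a # y) # z1)))) z) v =
        split_sum (\<lambda>x z. h z (split_sum (\<lambda>y z1. fst (G (M (a # y) # z1))) x)) v"
      by (simp add: split_sum_assoc split_sum_additive[OF h(1)])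
    also have "insertion_sum M (split_sum (\<lambda>x. block_sum G (\<lambda>r. \<phi> (G (a # x) # r)))) v
      = split_sum (\<lambda>x y. h y (insertion_sum M (\<lambda>r. fst (G (a # r))) x)
          + signed (word_degree x) (block_insertion_sum G (\<lambda>x. (insertion_sum M (\<lambda>r. fst (G r)) x, k x))
              (\<lambda>r. \<phi> (G (a # x) # r)) y)) v"
      unfolding insertion_sum_split_sum
      by (rule split_sum_cong[OF refl], subst less(1))
        (auto simp: Cons h slot_additive_Cons less(2) insertion_sum_additive[OF h(1)])
    finally show ?thesis
      by (simp add: Cons h additive.add[OF h(1)] additive.signed[OF h(1)] signed_add ac_simps
          flip: split_sum_add split_sum_signed)
  qed simp
qed

text \<open>
  The coalgebra morphism followed by a coderivation: the blocks that \<open>M\<close> combines form one larger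
  piece of the word, on which \<open>M\<close> is applied to the values of \<open>G\<close>.  The sign is the same
  before and after merging because \<open>G\<close> preserves degrees.
\<close>

lemma block_sum_insertion_sum:
  assumes "slot_additive \<phi>" and G: "\<And>x. x \<noteq> [] \<Longrightarrow> snd (G x) = word_degree x"
  shows "block_sum G (insertion_sum M \<phi>) w =
    block_insertion_sum G (\<lambda>x. (block_sum G (\<lambda>r. fst (M r)) x, k x)) \<phi> w"
  using assms(1)
proof (induction "length w" arbitrary: w \<phi> rule: less_induct)
  case less
  show ?case
  proof (cases w)
    case (Cons a v)
    define h where "h y c = block_sum G (\<lambda>r. \<phi> ((c, 0) # r)) y" for y c
    have h: "additive (h y)" "block_sum G (\<lambda>r. \<phi> (c # r)) y = h y (fst c)" for y c
      unfolding h_def using slot_additive_hd[OF less(2)] by blast+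
    have "block_sum G (insertion_sum M \<phi>) w =
        split_sum (\<lambda>x y. block_sum G (split_sum (\<lambda>s t. \<phi> (M (G (a # x) # s) # t))) y
         + signed (word_degree (a # x)) (block_sum G (insertion_sum M (\<lambda>r. \<phi> (G (a # x) # r))) y)) v"
      by (simp add: Cons block_sum_add block_sum_additive[OF additive_signed] G ac_simps cong: split_sum_cong)
    also have "\<dots> = split_sum (\<lambda>x y. block_sum G (split_sum (\<lambda>s t. \<phi> (M (G (a # x) # s) # t))) y) v
         + split_sum (\<lambda>x y. signed (word_degree (a # x)) (block_insertion_sum G
            (\<lambda>x. (block_sum G (\<lambda>r. fst (M r)) x, k x)) (\<lambda>r. \<phi> (G (a # x) # r)) y)) v"
      unfolding split_sum_add
      by (intro arg_cong2[of _ _ _ _ "(+)"] refl split_sum_cong, subst less(1))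
        (auto simp: Cons slot_additive_Cons less(2))
    also have "split_sum (\<lambda>x y. block_sum G (split_sum (\<lambda>s t. \<phi> (M (G (a # x) # s) # t))) y) v
        = split_sum (\<lambda>x y. h y (block_sum G (\<lambda>r. fst (M r)) (a # x))) v"
      by (simp add: block_sum_split_sum h(2) block_sum_additive[OF h(1)] split_sum_assoc
          split_sum_additive[OF h(1)])
    finally show ?thesis by (simp add: Cons h flip: split_sum_add)
  qed simp
qed

section \<open>Shuffles and coalgebra morphisms\<close>

text \<open>
  \<open>\<phi>\<close> applied to the signed shuffle product of two words, by recursion on its first letter.
\<close>

fun shuffle_sum :: "(('a \<times> int) list \<Rightarrow> 'c::ab_group_add) \<Rightarrow> ('a \<times> int) list \<Rightarrow> ('a \<times> int) list \<Rightarrow> 'c"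
where
  "shuffle_sum \<phi> [] v = \<phi> v"
| "shuffle_sum \<phi> (a # u) [] = \<phi> (a # u)"
| "shuffle_sum \<phi> (a # u) (b # v) = shuffle_sum (\<lambda>r. \<phi> (a # r)) u (b # v)
    + signed (snd b * word_degree (a # u)) (shuffle_sum (\<lambda>r. \<phi> (b # r)) (a # u) v)"

lemma shuffle_sum_Nil_right [simp]: "shuffle_sum \<phi> u [] = \<phi> u"
  by (cases u) auto

lemma shuffle_sum_add:
  "shuffle_sum (\<lambda>r. \<phi> r + \<psi> r) u v = shuffle_sum \<phi> u v + shuffle_sum \<psi> u v"
proof (induction \<phi> u v arbitrary: \<psi> rule: shuffle_sum.induct)
  case (3 \<phi> a u b v)
  show ?case by (simp add: 3 signed_add)
qed simp_all

lemma shuffle_sum_functional: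
  assumes "additive_functional \<Phi>"
  shows "shuffle_sum (\<lambda>r. \<Phi> (\<lambda>z. F z r)) u v = \<Phi> (\<lambda>z. shuffle_sum (F z) u v)"
proof (induction u arbitrary: F v)
  case (Cons a u)
  show ?case
    by (induction v arbitrary: F)
      (simp_all add: Cons additive_functionalD[OF assms] additive_functional_signed[OF assms])
qed simp

lemma shuffle_sum_additive:
  assumes "additive h"
  shows "shuffle_sum (\<lambda>r. h (\<phi> r)) u v = h (shuffle_sum \<phi> u v)"
  by (induction \<phi> u v rule: shuffle_sum.induct)
    (simp_all add: additive.add[OF assms] additive.signed[OF assms])

lemma shuffle_sum_zero: "shuffle_sum (\<lambda>_. 0) u v = 0"
  using shuffle_sum_add[of "\<lambda>_. 0" "\<lambda>_. 0" u v] by simp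

lemma shuffle_sum_cong:
  assumes "\<And>r. length r = length u + length v \<Longrightarrow> set r = set u \<union> set v \<Longrightarrow> \<phi> r = \<psi> r"
  shows "shuffle_sum \<phi> u v = shuffle_sum \<psi> u v"
  using assms
proof (induction \<phi> u v arbitrary: \<psi> rule: shuffle_sum.induct)
  case (3 \<phi> a u b v)
  have "shuffle_sum (\<lambda>r. \<phi> (a # r)) u (b # v) = shuffle_sum (\<lambda>r. \<psi> (a # r)) u (b # v)"
    "shuffle_sum (\<lambda>r. \<phi> (b # r)) (a # u) v = shuffle_sum (\<lambda>r. \<psi> (b # r)) (a # u) v"
    by (rule 3; rule 3; auto)+
  then show ?case by simp
qed auto

text \<open>
  Deconcatenation is multiplicative for the shuffle product: the prefix of a shuffle is a
  shuffle of a prefix of \<open>u\<close> with a prefix of \<open>v\<close>.  The sign comes from the letters of \<open>v1\<close>, which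
  overtake all letters of \<open>u2\<close>.
\<close>

lemma shuffle_sum_split_sum:
  "shuffle_sum (split_sum F) u v = split_sum (\<lambda>u1 u2. split_sum (\<lambda>v1 v2.
    signed (word_degree v1 * word_degree u2) (shuffle_sum (\<lambda>x. shuffle_sum (F x) u2 v2) u1 v1)) v) u"
proof (induction u arbitrary: F v)
  case IHu: (Cons a u)
  show ?case
  proof (induction v arbitrary: F)
    case IHv: (Cons b v)
    have "signed (snd b * word_degree (a # u)) (shuffle_sum (split_sum (\<lambda>x. F (b # x))) (a # u) v) =
        split_sum (\<lambda>v1 v2. signed (word_degree (b # v1) * word_degree (a # u))
          (shuffle_sum (F (b # v1)) (a # u) v2)) v
        + split_sum (\<lambda>u1 u2. split_sum (\<lambda>v1 v2.
          signed (word_degree (b # v1) * word_degree u2 + snd b * word_degree (a # u1))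
          (shuffle_sum (\<lambda>x. shuffle_sum (F (b # x)) u2 v2) (a # u1) v1)) v) u" (is "?l = ?A + ?B")
    proof -
      have "?l = ?A + split_sum (\<lambda>u1 u2. split_sum (\<lambda>v1 v2.
          signed (snd b * word_degree (a # u) + word_degree v1 * word_degree u2)
          (shuffle_sum (\<lambda>x. shuffle_sum (F (b # x)) u2 v2) (a # u1) v1)) v) u"
        by (simp add: IHv signed_add algebra_simps flip: split_sum_signed)
      also have "split_sum (\<lambda>u1 u2. split_sum (\<lambda>v1 v2.
          signed (snd b * word_degree (a # u) + word_degree v1 * word_degree u2)
          (shuffle_sum (\<lambda>x. shuffle_sum (F (b # x)) u2 v2) (a # u1) v1)) v) u = ?B"
        by (intro split_sum_cong[OF refl]) (auto simp: algebra_simps)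
      finally show ?thesis .
    qed
    then show ?case
      by (simp add: shuffle_sum_add IHu split_sum_add signed_add ac_simps)
  qed simp
qed simp

lemma block_sum_nonempty:
  "w \<noteq> [] \<Longrightarrow> block_sum G \<phi> w =
    split_sum (\<lambda>x y. if x = [] then 0 else block_sum G (\<lambda>r. \<phi> (G x # r)) y) w"
  by (cases w) auto

lemma block_sum_cong_degree:
  assumes G: "\<And>x. x \<noteq> [] \<Longrightarrow> snd (G x) = word_degree x"
    and "\<And>r. word_degree r = word_degree w \<Longrightarrow> \<phi> r = \<psi> r"
  shows "block_sum G \<phi> w = block_sum G \<psi> w"
  using assms(2)
proof (induction "length w" arbitrary: w \<phi> \<psi> rule: less_induct)
  case less
  show ?case
  proof (cases w)
    case (Cons a v)
    show ?thesis unfolding Cons block_sum.simps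
      by (intro split_sum_cong[OF refl] less(1)) (auto simp: Cons G intro!: less(2))
  qed (use less in auto)
qed

text \<open>
  If \<open>G\<close> annihilates shuffles, the coalgebra morphism of \<open>G\<close> is multiplicative for the shuffle
  product.  The vanishing is demanded only in a context \<open>p\<close>, \<open>s\<close> of bounded length under \<open>\<phi>\<close>: with empty
  context it concerns a single block, and a function that is zero on words of length one
  reduces the condition to blocks that are strictly shorter than the whole word.
\<close>

lemma shuffle_sum_block_sum:
  fixes G :: "('b \<times> int) list \<Rightarrow> 'a \<times> int" and \<phi> :: "('a \<times> int) list \<Rightarrow> 'c::ab_group_add"
  assumes G: "\<And>x. x \<noteq> [] \<Longrightarrow> snd (G x) = word_degree x"
    and "\<And>p s x y. x \<noteq> [] \<Longrightarrow> y \<noteq> [] \<Longrightarrow> set x \<subseteq> set u \<Longrightarrow> set y \<subseteq> set v \<Longrightarrow>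
      length p + length x + length y + length s \<le> length u + length v \<Longrightarrow>
      shuffle_sum (\<lambda>z. \<phi> (p @ G z # s)) x y = 0"
  shows "shuffle_sum (block_sum G \<phi>) u v =
    block_sum G (\<lambda>U. block_sum G (\<lambda>V. shuffle_sum \<phi> U V) v) u"
  using assms(2)
proof (induction "length u + length v" arbitrary: u v \<phi> rule: less_induct)
  case less
  note vanish = less(2)
  show ?case
  proof (cases "u = [] \<or> v = []")
    case True
    then show ?thesis by (auto simp: shuffle_sum.simps(1)[abs_def])
  next
    case False
    then have ne: "u \<noteq> []" "v \<noteq> []" by auto
    define F where "F x y = (if x = [] then 0 else block_sum G (\<lambda>r. \<phi> (G x # r)) y)" for x y
    have F_Nil: "F [] = (\<lambda>y. 0)" by (simp add: F_def fun_eq_iff)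
    have "shuffle_sum (block_sum G \<phi>) u v = shuffle_sum (split_sum F) u v"
    proof (rule shuffle_sum_cong)
      fix r :: "('b \<times> int) list" assume "length r = length u + length v"
      then have "r \<noteq> []" using ne by auto
      then show "block_sum G \<phi> r = split_sum F r" by (simp add: block_sum_nonempty F_def[abs_def])
    qed
    \<comment> \<open>The first block is a shuffle of prefixes \<open>u1\<close> and \<open>v1\<close>; it contributes only if exactly one of
      them is empty.\<close>
    also have "\<dots> = split_sum (\<lambda>u1 u2. split_sum (\<lambda>v1 v2.
        (if v1 = [] then if u1 = [] then 0 else shuffle_sum (F u1) u2 v2 else 0)
        + (if u1 = [] then if v1 = [] then 0 else signed (word_degree v1 * word_degree u2) (shuffle_sum (F v1) u2 v2) else 0)) v) u"
      unfolding shuffle_sum_split_sum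
    proof (intro split_sum_cong[OF refl])
      fix u1 u2 v1 v2 assume uv: "u1 @ u2 = u" "v1 @ v2 = v"
      have "shuffle_sum (\<lambda>x. shuffle_sum (F x) u2 v2) u1 v1 = 0" if ne': "u1 \<noteq> []" "v1 \<noteq> []"
      proof -
        define \<Phi> where "\<Phi> A = shuffle_sum (block_sum G A) u2 v2" for A :: "_ \<Rightarrow> 'c"
        have "additive_functional \<Phi>"
          unfolding \<Phi>_def additive_functional_def
          by (simp add: block_sum_add[abs_def] shuffle_sum_add)
        have "shuffle_sum (\<lambda>x. shuffle_sum (F x) u2 v2) u1 v1
            = shuffle_sum (\<lambda>x. \<Phi> (\<lambda>r. \<phi> (G x # r))) u1 v1"
        proof (rule shuffle_sum_cong)
          fix r :: "('b \<times> int) list" assume "length r = length u1 + length v1"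
          then have "r \<noteq> []" using ne' by auto
          then show "shuffle_sum (F r) u2 v2 = \<Phi> (\<lambda>q. \<phi> (G r # q))" by (simp add: F_def[abs_def] \<Phi>_def)
        qed
        also have "\<dots> = \<Phi> (\<lambda>r. shuffle_sum (\<lambda>x. \<phi> (G x # r)) u1 v1)"
          by (rule shuffle_sum_functional) fact
        also have "\<dots> = \<Phi> (\<lambda>r. 0)"
          unfolding \<Phi>_def
        proof (intro shuffle_sum_cong block_sum_cong)
          fix q :: "('b \<times> int) list" and r :: "('a \<times> int) list"
          assume "length q = length u2 + length v2" "length r \<le> length q"
          then show "shuffle_sum (\<lambda>x. \<phi> (G x # r)) u1 v1 = 0"
            using vanish[of u1 v1 "[]" r] ne' uv by auto
        qed
        finally show ?thesis using \<open>additive_functional \<Phi>\<close> additive_functional_zero by metis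
      qed
      then show "signed (word_degree v1 * word_degree u2) (shuffle_sum (\<lambda>x. shuffle_sum (F x) u2 v2) u1 v1) =
        (if v1 = [] then if u1 = [] then 0 else shuffle_sum (F u1) u2 v2 else 0)
        + (if u1 = [] then if v1 = [] then 0 else signed (word_degree v1 * word_degree u2) (shuffle_sum (F v1) u2 v2) else 0)"
        by (auto simp: F_Nil shuffle_sum_zero)
    qed
    also have "\<dots> = split_sum (\<lambda>u1 u2. if u1 = [] then 0 else shuffle_sum (F u1) u2 v) u
        + split_sum (\<lambda>v1 v2. if v1 = [] then 0 else signed (word_degree v1 * word_degree u) (shuffle_sum (F v1) u v2)) v"
      (is "_ = ?A + ?B")
    proof -
      have "split_sum (\<lambda>u1 u2. split_sum (\<lambda>v1 v2. if u1 = [] then if v1 = [] then 0 else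
          signed (word_degree v1 * word_degree u2) (shuffle_sum (F v1) u2 v2) else 0) v) u =
        split_sum (\<lambda>u1 u2. if u1 = [] then split_sum (\<lambda>v1 v2. if v1 = [] then 0 else
          signed (word_degree v1 * word_degree u2) (shuffle_sum (F v1) u2 v2)) v else 0) u"
        by (rule split_sum_cong) (auto intro: split_sum_zero)
      then show ?thesis by (simp add: split_sum_add split_sum_left_Nil)
    qed
    \<comment> \<open>A first block taken from \<open>u\<close> leaves a shuffle of \<open>u2\<close> and \<open>v\<close>, to which the induction
      hypothesis applies; on the other side it is the first letter of the word of blocks of \<open>u\<close>.\<close>
    also have "?A = split_sum (\<lambda>u1 u2. if u1 = [] then 0 else
        block_sum G (\<lambda>U. block_sum G (\<lambda>V. shuffle_sum (\<lambda>r. \<phi> (G u1 # r)) U V) v) u2) u"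
    proof (rule split_sum_cong[OF refl])
      fix u1 u2 assume uv: "u1 @ u2 = u"
      have "shuffle_sum (F u1) u2 v =
        block_sum G (\<lambda>U. block_sum G (\<lambda>V. shuffle_sum (\<lambda>r. \<phi> (G u1 # r)) U V) v) u2" if "u1 \<noteq> []"
        unfolding F_def[abs_def] using that
      proof (simp, intro less(1), goal_cases)
        case (2 x y p s)
        then have "shuffle_sum (\<lambda>z. \<phi> ((G u1 # p) @ G z # s)) x y = 0"
          by (intro vanish) (use uv in \<open>auto simp flip: length_greater_0_conv\<close>)
        then show ?case by simp
      qed (use uv in auto)
      then show "(if u1 = [] then 0 else shuffle_sum (F u1) u2 v) = (if u1 = [] then 0 else
        block_sum G (\<lambda>U. block_sum G (\<lambda>V. shuffle_sum (\<lambda>r. \<phi> (G u1 # r)) U V) v) u2)" by auto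
    qed
    also have "\<dots> = block_sum G (\<lambda>U. block_sum G (\<lambda>V. shuffle_sum (\<lambda>r. \<phi> (hd U # r)) (tl U) V) v) u"
      by (simp add: block_sum_nonempty[OF ne(1)] cong: if_cong)
    \<comment> \<open>The same for a first block taken from \<open>v\<close>, which has to overtake all of \<open>u\<close>.\<close>
    also have "?B = split_sum (\<lambda>v1 v2. if v1 = [] then 0 else block_sum G (\<lambda>U. block_sum G
        (\<lambda>V. signed (word_degree v1 * word_degree u) (shuffle_sum (\<lambda>r. \<phi> (G v1 # r)) U V)) v2) u) v"
    proof (rule split_sum_cong[OF refl])
      fix v1 v2 assume uv: "v1 @ v2 = v"
      have "shuffle_sum (F v1) u v2 =
        block_sum G (\<lambda>U. block_sum G (\<lambda>V. shuffle_sum (\<lambda>r. \<phi> (G v1 # r)) U V) v2) u" if "v1 \<noteq> []"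
        unfolding F_def[abs_def] using that
      proof (simp, intro less(1), goal_cases)
        case (2 x y p s)
        then have "shuffle_sum (\<lambda>z. \<phi> ((G v1 # p) @ G z # s)) x y = 0"
          by (intro vanish) (use uv in \<open>auto simp flip: length_greater_0_conv\<close>)
        then show ?case by simp
      qed (use uv in auto)
      then show "(if v1 = [] then 0 else signed (word_degree v1 * word_degree u) (shuffle_sum (F v1) u v2)) =
        (if v1 = [] then 0 else block_sum G (\<lambda>U. block_sum G
        (\<lambda>V. signed (word_degree v1 * word_degree u) (shuffle_sum (\<lambda>r. \<phi> (G v1 # r)) U V)) v2) u)"
        by (simp add: additive_functional_signed[OF additive_functional_block_sum])
    qed
    also have "\<dots> = split_sum (\<lambda>v1 v2. block_sum G (\<lambda>U. if v1 = [] then 0 else block_sum G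
        (\<lambda>V. signed (word_degree v1 * word_degree u) (shuffle_sum (\<lambda>r. \<phi> (G v1 # r)) U V)) v2) u) v"
      by (rule split_sum_cong)
        (auto simp: additive_functional_zero[OF additive_functional_block_sum])
    also have "\<dots> = block_sum G (\<lambda>U. split_sum (\<lambda>v1 v2. if v1 = [] then 0 else block_sum G
        (\<lambda>V. signed (word_degree v1 * word_degree u) (shuffle_sum (\<lambda>r. \<phi> (G v1 # r)) U V)) v2) v) u"
      by (rule split_sum_functional[OF additive_functional_block_sum])
    also have "\<dots> = block_sum G (\<lambda>U. block_sum G (\<lambda>V. signed (snd (hd V) * word_degree u)
        (shuffle_sum (\<lambda>r. \<phi> (hd V # r)) U (tl V))) v) u"
      unfolding block_sum_nonempty[OF ne(2)]
      by (intro block_sum_cong split_sum_cong refl if_cong) (simp add: G)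
    \<comment> \<open>\<open>G\<close> preserves degrees, so the sign is the one in the recursion of \<open>shuffle_sum\<close>.\<close>
    also have "\<dots> = block_sum G (\<lambda>U. block_sum G (\<lambda>V. signed (snd (hd V) * word_degree U)
        (shuffle_sum (\<lambda>r. \<phi> (hd V # r)) U (tl V))) v) u"
      by (rule block_sum_cong_degree[OF G]) simp_all
    also have "block_sum G (\<lambda>U. block_sum G (\<lambda>V. shuffle_sum (\<lambda>r. \<phi> (hd U # r)) (tl U) V) v) u + \<dots>
      = block_sum G (\<lambda>U. block_sum G (\<lambda>V. shuffle_sum \<phi> U V) v) u"
      unfolding block_sum_add[symmetric]
    proof (intro block_sum_cong)
      fix U V :: "('a \<times> int) list"
      assume "(U = []) = (u = [])" "(V = []) = (v = [])"
      then obtain a U' b V' where "U = a # U'" "V = b # V'" using ne by (metis list.exhaust)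
      then show "shuffle_sum (\<lambda>r. \<phi> (hd U # r)) (tl U) V
          + signed (snd (hd V) * word_degree U) (shuffle_sum (\<lambda>r. \<phi> (hd V # r)) U (tl V)) = shuffle_sum \<phi> U V"
        by simp
    qed
    finally show ?thesis .
  qed
qed

section \<open>Planar forests as cuts into blocks\<close>

lemma length_forest_map [simp]: "length (forest_map m g H ts bs) = length ts"
  by (induction ts arbitrary: bs) auto

text \<open>
  The lists of subtrees that can hang off a vertex above \<open>n\<close> tails, together with the empty list
  and the lists of length one, so that forests can be built up one tree at a time.
\<close>

definition planar_forests :: "nat \<Rightarrow> planar_tree list set" where
  "planar_forests n = {ts. (\<forall>t \<in> set ts. reduced t) \<and> (\<Sum>t\<leftarrow>ts. num_tails t) = n}"

lemma planar_forests_0: "planar_forests 0 = {[]}"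
proof -
  have "ts = []" if "ts \<in> planar_forests 0" for ts
    using that by (cases ts) (auto simp: planar_forests_def dest: num_tails_pos)
  then show ?thesis by (auto simp: planar_forests_def)
qed

lemma planar_forests_Suc:
  "planar_forests (Suc n) =
    (\<lambda>(i, t, ts). t # ts) ` (SIGMA i:{..n}. planar_trees (Suc i) \<times> planar_forests (n - i))"
proof (intro equalityI subsetI)
  fix ts assume ts: "ts \<in> planar_forests (Suc n)"
  then obtain t us where "ts = t # us" by (cases ts) (auto simp: planar_forests_def)
  moreover from this ts obtain i where "num_tails t = Suc i"
    using num_tails_pos[of t] by (auto simp: planar_forests_def gr0_conv_Suc)
  ultimately show "ts \<in> (\<lambda>(i, t, ts). t # ts) `
      (SIGMA i:{..n}. planar_trees (Suc i) \<times> planar_forests (n - i))"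
    using ts by (intro image_eqI[of _ _ "(i, t, us)"])
      (auto simp: planar_forests_def planar_trees_def)
qed (auto simp: planar_forests_def planar_trees_def)

lemma finite_planar_forests: "finite (planar_forests n)"
proof (induction n rule: less_induct)
  case (less n)
  show ?case
  proof (cases n)
    case (Suc k)
    have "finite (planar_forests (k - i))" for i by (rule less) (simp add: Suc)
    then show ?thesis unfolding Suc planar_forests_Suc by (simp add: finite_planar_trees)
  qed (simp add: planar_forests_0)
qed

lemma sum_planar_forests_Suc:
  "(\<Sum>ts \<in> planar_forests (Suc n). F ts) =
    (\<Sum>i\<le>n. \<Sum>t \<in> planar_trees (Suc i). \<Sum>ts \<in> planar_forests (n - i). F (t # ts))"
proof -
  have "inj_on (\<lambda>(i, t, ts). t # ts) (SIGMA i:{..n}. planar_trees (Suc i) \<times> planar_forests (n - i))"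
    by (auto simp: inj_on_def planar_trees_def)
  then show ?thesis
    unfolding planar_forests_Suc
    by (subst sum.reindex)
      (simp_all add: sum.Sigma finite_planar_trees finite_planar_forests sum.cartesian_product
        split_beta comp_def)
qed

lemma sum_planar_trees:
  "(\<Sum>T \<in> planar_trees n. F T) = (if n = 1 then F Tail else 0)
    + (\<Sum>ts \<in> planar_forests n. if length ts \<ge> 2 then F (Vertex ts) else 0)"
proof -
  let ?V = "Vertex ` {ts \<in> planar_forests n. length ts \<ge> 2}"
  have trees: "planar_trees n = (if n = 1 then {Tail} else {}) \<union> ?V"
  proof (intro equalityI subsetI)
    fix T assume "T \<in> planar_trees n"
    then show "T \<in> (if n = 1 then {Tail} else {}) \<union> ?V"
      by (cases T) (auto simp: planar_trees_def planar_forests_def)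
  qed (auto simp: planar_trees_def planar_forests_def split: if_splits)
  have "(\<Sum>T \<in> planar_trees n. F T) = (\<Sum>T \<in> (if n = 1 then {Tail} else {}). F T) + (\<Sum>T \<in> ?V. F T)"
    unfolding trees by (rule sum.union_disjoint) (auto simp: finite_planar_forests)
  also have "(\<Sum>T \<in> ?V. F T) = (\<Sum>ts \<in> planar_forests n. if length ts \<ge> 2 then F (Vertex ts) else 0)"
    by (subst sum.reindex) (auto simp: inj_on_def sum.inter_filter finite_planar_forests)
  finally show ?thesis by simp
qed

text \<open>
  A forest determines the cut of the word into the pieces above its trees; once the cut is fixed, the
  trees vary independently, and by slot additivity the sum over them moves inside \<open>\<phi>\<close>.
\<close>

lemma sum_forests_eq_block_sum:
  assumes "slot_additive \<phi>"
    and G: "\<And>x. G x = (\<Sum>T \<in> planar_trees (length x). subtree_map m g H T (map fst x), k x)"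
  shows "block_sum G \<phi> w =
    (\<Sum>ts \<in> planar_forests (length w). \<phi> (map (\<lambda>a. (a, 0)) (forest_map m g H ts (map fst w))))"
  using assms(1)
proof (induction "length w" arbitrary: w \<phi> rule: less_induct)
  case less
  show ?case
  proof (cases w)
    case (Cons a v)
    let ?r = "\<lambda>ts y. map (\<lambda>a. (a, 0)) (forest_map m g H ts (map fst y))"
    have head: "\<phi> (G x # r) = (\<Sum>T \<in> planar_trees (length x). \<phi> ((subtree_map m g H T (map fst x), 0) # r))" for x r
    proof -
      have "additive (\<lambda>c. \<phi> ((c, 0) # r))"
        using slot_additive_additive[OF less(2), of "[]"] by simp
      then show ?thesis
        using slot_additive_degree[OF less(2), of "[]" "fst (G x)" "k x" r 0]
        by (simp add: G additive.sum[of "\<lambda>c. \<phi> ((c, 0) # r)"])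
    qed
    have "block_sum G \<phi> w = split_sum (\<lambda>x y. \<Sum>ts \<in> planar_forests (length y). \<phi> (G (a # x) # ?r ts y)) v"
      unfolding Cons block_sum.simps
      by (intro split_sum_cong[OF refl] less(1)) (auto simp: Cons intro: slot_additive_Cons less(2))
    also have "\<dots> = (\<Sum>i\<le>length v. \<Sum>T \<in> planar_trees (Suc i). \<Sum>ts \<in> planar_forests (length v - i).
        \<phi> ((subtree_map m g H T (fst a # map fst (take i v)), 0) # ?r ts (drop i v)))"
      by (simp add: split_sum_eq_sum head sum.swap[where A = "planar_forests k" for k])
    also have "\<dots> = (\<Sum>ts \<in> planar_forests (length w). \<phi> (?r ts w))"
      by (simp add: Cons sum_planar_forests_Suc planar_trees_def take_map drop_map)
    finally show ?thesis .
  qed (simp add: planar_forests_0)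
qed

section \<open>Words with a zero letter\<close>

lemma slot_additive_mem_zero: "slot_additive \<phi> \<Longrightarrow> (0, i) \<in> set r \<Longrightarrow> \<phi> r = 0"
  by (metis slot_additive_zero split_list)

text \<open>
  A zero letter is either an argument of \<open>M\<close> or remains an argument of \<open>\<phi>\<close>.
\<close>

lemma insertion_sum_mem_zero:
  assumes "slot_additive \<phi>" "slot_additive (\<lambda>y. fst (M y))" "(0, i) \<in> set w"
  shows "insertion_sum M \<phi> w = 0"
  using assms(1,3)
proof (induction w arbitrary: \<phi>)
  case (Cons a w)
  have "split_sum (\<lambda>y z. \<phi> (M (a # y) # z)) w = 0"
  proof (rule split_sum_zero)
    fix y z assume "y @ z = w"
    then consider "(0, i) \<in> set (a # y)" | "(0, i) \<in> set z" using Cons.prems by auto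
    then show "\<phi> (M (a # y) # z) = 0"
    proof cases
      case 1
      then have "fst (M (a # y)) = 0" by (rule slot_additive_mem_zero[OF assms(2)])
      then show ?thesis using slot_additive_zero[OF Cons.prems(1), of "[]"] by (cases "M (a # y)") auto
    qed (auto intro: slot_additive_mem_zero[OF Cons.prems(1)])
  qed
  moreover have "insertion_sum M (\<lambda>r. \<phi> (a # r)) w = 0"
  proof (cases "(0, i) \<in> set w")
    case True
    then show ?thesis using Cons slot_additive_Cons by blast
  next
    case False
    then have "\<phi> (a # r) = 0" for r using Cons.prems by (auto intro: slot_additive_mem_zero)
    then show ?thesis using insertion_sum_additive[of "\<lambda>_. 0"] by (simp add: additive_def)
  qed
  ultimately show ?case by simp
qed simp

section \<open>Relations and shuffles in terms of positions\<close>

text \<open>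
  The indexing by the valence \<open>k\<close> and the position \<open>j\<close> in which \<open>A\<^sub>\<infinity>\<close>-relations are stated.
\<close>

lemma insertion_sum_eq_sum:
  fixes \<phi> :: "('a \<times> int) list \<Rightarrow> 'c::ab_group_add"
  shows "insertion_sum M \<phi> w = (\<Sum>k = 1..length w. \<Sum>j = 0..length w - k.
    signed (word_degree (take j w)) (\<phi> (take j w @ [M (take k (drop j w))] @ drop (j + k) w)))"
proof -
  define c where "c \<phi> w j k = signed (word_degree (take j w)) (\<phi> (take j w @ [M (take k (drop j w))] @ drop (j + k) w))"
    for \<phi> :: "('a \<times> int) list \<Rightarrow> 'c" and w j k
  have "insertion_sum M \<phi> w = (\<Sum>j<length w. \<Sum>k<length w - j. c \<phi> w j (Suc k))"
  proof (induction w arbitrary: \<phi>)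
    case (Cons a w)
    have "signed (snd a) (c (\<lambda>r. \<phi> (a # r)) w j k) = c \<phi> (a # w) (Suc j) k" for j k
      by (simp add: c_def)
    then have "signed (snd a) (insertion_sum M (\<lambda>r. \<phi> (a # r)) w) =
      (\<Sum>j<length w. \<Sum>k<length w - j. c \<phi> (a # w) (Suc j) (Suc k))"
      by (simp add: Cons additive.sum[OF additive_signed])
    moreover have "split_sum (\<lambda>y z. \<phi> (M (a # y) # z)) w = (\<Sum>k<Suc (length w). c \<phi> (a # w) 0 (Suc k))"
      by (simp add: split_sum_eq_sum c_def lessThan_Suc_atMost)
    ultimately show ?case by (simp add: sum.lessThan_Suc_shift del: sum.lessThan_Suc)
  qed simp
  also have "\<dots> = (\<Sum>j<length w. \<Sum>k = 1..length w - j. c \<phi> w j k)"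
    by (simp add: sum.atLeast1_atMost_eq)
  also have "\<dots> = (\<Sum>k = 1..length w. \<Sum>j = 0..length w - k. c \<phi> w j k)"
    unfolding sum.Sigma[OF finite_lessThan ballI[OF finite_atLeastAtMost]]
      sum.Sigma[OF finite_atLeastAtMost ballI[OF finite_atLeastAtMost]]
    by (rule sum.reindex_bij_witness[of _ prod.swap prod.swap]) auto
  finally show ?thesis by (simp add: c_def)
qed

lemma shuffle_sum_mem_zero:
  assumes "slot_additive \<phi>" "(0, i) \<in> set u \<union> set v"
  shows "shuffle_sum \<phi> u v = 0"
proof -
  have "shuffle_sum \<phi> u v = shuffle_sum (\<lambda>_. 0) u v"
    by (rule shuffle_sum_cong) (use assms in \<open>auto intro: slot_additive_mem_zero\<close>)
  then show ?thesis by (simp add: shuffle_sum_zero)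
qed

abbreviation shuffle_sets :: "nat \<Rightarrow> nat \<Rightarrow> nat set set" where
  "shuffle_sets p q \<equiv> {I. I \<subseteq> {..<p + q} \<and> card I = p}"

lemma finite_shuffle_sets: "finite (shuffle_sets p q)"
  by (rule finite_subset[of _ "Pow {..<p + q}"]) auto

text \<open>
  A shuffle starts with a letter of \<open>u\<close> exactly if 0 belongs to its set of positions; removing
  that first letter shifts all other positions by one.
\<close>

lemma shuffle_word_insert:
  "shuffle_word (a # u) v (insert 0 (Suc ` J)) = a # shuffle_word u v J"
proof -
  have 1: "insert 0 (Suc ` J) \<inter> {..<Suc k} = insert 0 (Suc ` (J \<inter> {..<k}))" for k
    by (auto simp: lessThan_Suc_eq_insert_0)
  have 2: "{..<Suc k} - insert 0 (Suc ` J) = Suc ` ({..<k} - J)" for k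
    by (auto simp: lessThan_Suc_eq_insert_0)
  show ?thesis
    by (simp add: shuffle_word_def upt_conv_Cons map_Suc_upt[symmetric] 1 2 card_image del: upt_Suc)
      (auto simp: card_insert_if card_image)
qed

lemma shuffle_word_image:
  "shuffle_word u (b # v) (Suc ` J) = b # shuffle_word u v J"
proof -
  have 1: "Suc ` J \<inter> {..<Suc k} = Suc ` (J \<inter> {..<k})" for k
    by (auto simp: lessThan_Suc_eq_insert_0)
  have 2: "{..<Suc k} - Suc ` J = insert 0 (Suc ` ({..<k} - J))" for k
    by (auto simp: lessThan_Suc_eq_insert_0)
  show ?thesis
    by (simp add: shuffle_word_def upt_conv_Cons map_Suc_upt[symmetric] 1 2 card_image del: upt_Suc)
      (auto simp: card_insert_if card_image)
qed

lemma length_shuffle_word [simp]: "length (shuffle_word u v I) = length u + length v"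
  by (simp add: shuffle_word_def)

lemma set_shuffle_word:
  assumes "I \<in> shuffle_sets (length u) (length v)"
  shows "set (shuffle_word u v I) \<subseteq> set u \<union> set v"
proof -
  let ?n = "length u + length v"
  have fin: "finite I" using assms finite_subset by auto
  have "card ({..<?n} - I) = length v" using assms fin by (simp add: card_Diff_subset)
  moreover have "card ({..<k} - I) < card ({..<?n} - I)" if "k < ?n" "k \<notin> I" for k
    by (rule psubset_card_mono) (use that in auto)
  moreover have "card (I \<inter> {..<k}) < card I" if "k \<in> I" for k
    by (rule psubset_card_mono) (use that fin in auto)
  ultimately show ?thesis using assms by (auto simp: shuffle_word_def)
qed

lemma sum_shuffle_word:
  assumes "I \<in> shuffle_sets (length u) (length v)"
  shows "(\<Sum>i\<in>I. h (shuffle_word u v I ! i)) = (\<Sum>a\<leftarrow>u. h a)"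
proof -
  define c where "c i = card (I \<inter> {..<i})" for i
  have fin: "finite I" using assms finite_subset by auto
  have less: "c i < c j" if "i \<in> I" "j \<in> I" "i < j" for i j
    unfolding c_def by (rule psubset_card_mono) (use that fin in auto)
  have inj: "inj_on c I"
    by (metis (no_types, lifting) inj_onI less less_irrefl linorder_neqE_nat)
  have "c i < length u" if "i \<in> I" for i
    using assms psubset_card_mono[OF fin, of "I \<inter> {..<i}"] that by (auto simp: c_def)
  \<comment> \<open>Counting the earlier positions in \<open>I\<close> numbers the elements of \<open>I\<close> in order.\<close>
  then have "c ` I = {..<length u}"
    using assms by (intro card_subset_eq) (auto simp: card_image inj)
  then have "(\<Sum>i\<in>I. h (u ! c i)) = (\<Sum>k<length u. h (u ! k))"
    using sum.reindex[OF inj, of "\<lambda>k. h (u ! k)"] by simp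
  moreover have "shuffle_word u v I ! i = u ! c i" if "i \<in> I" for i
  proof -
    have "i < length u + length v" using that assms by auto
    then show ?thesis using that by (simp add: shuffle_word_def c_def)
  qed
  ultimately show ?thesis by (simp add: sum_list_sum_nth atLeast0LessThan)
qed

lemma shuffle_exponent_insert:
  "shuffle_exponent V (a # u) v (insert 0 (Suc ` J)) = shuffle_exponent V u v J"
proof -
  have "{(i, j). i \<in> insert 0 (Suc ` J) \<and> j \<in> {..<length (a # u) + length v} - insert 0 (Suc ` J) \<and> j < i}
    = map_prod Suc Suc ` {(i, j). i \<in> J \<and> j \<in> {..<length u + length v} - J \<and> j < i}"
    by (auto simp: lessThan_Suc_eq_insert_0 image_iff)
  then show ?thesis
    by (simp add: shuffle_exponent_def shuffle_word_insert Let_def)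
      (simp add: sum.reindex inj_on_def split_beta map_prod_def)
qed

text \<open>
  A letter of \<open>v\<close> in front is inverted with every letter of \<open>u\<close>.
\<close>

lemma shuffle_exponent_image:
  assumes "J \<in> shuffle_sets (length u) (length v)"
  shows "shuffle_exponent V u (b # v) (Suc ` J) =
    deg V b * (\<Sum>a\<leftarrow>u. deg V a) + shuffle_exponent V u v J"
proof -
  let ?X = "{(i, j). i \<in> J \<and> j \<in> {..<length u + length v} - J \<and> j < i}"
  have fin: "finite J" using assms finite_subset by auto
  have "finite ?X"
    by (rule finite_subset[of _ "J \<times> {..<length u + length v}"]) (use fin in auto)
  have X: "{(i, j). i \<in> Suc ` J \<and> j \<in> {..<length u + length (b # v)} - Suc ` J \<and> j < i}
    = (\<lambda>i. (Suc i, 0)) ` J \<union> map_prod Suc Suc ` ?X"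
    by (auto simp: lessThan_Suc_eq_insert_0 image_iff)
  show ?thesis
    unfolding shuffle_exponent_def shuffle_word_image Let_def X
    by (subst sum.union_disjoint)
      (use fin \<open>finite ?X\<close> in \<open>auto simp: sum.reindex inj_on_def split_beta map_prod_def
        sum_distrib_left[symmetric] sum_shuffle_word[OF assms] mult.commute\<close>)
qed

lemma sum_shuffle_sets_Cons:
  "(\<Sum>I \<in> shuffle_sets (Suc p) (Suc q). F I) =
    (\<Sum>J \<in> shuffle_sets p (Suc q). F (insert 0 (Suc ` J))) + (\<Sum>J \<in> shuffle_sets (Suc p) q. F (Suc ` J))"
proof -
  have sets: "shuffle_sets (Suc p) (Suc q) =
    (\<lambda>J. insert 0 (Suc ` J)) ` shuffle_sets p (Suc q) \<union> (\<lambda>J. Suc ` J) ` shuffle_sets (Suc p) q" (is "?l = ?r")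
  proof (intro equalityI subsetI)
    fix I assume I: "I \<in> ?l"
    define J where "J = Suc -` I"
    have fin: "finite J" unfolding J_def by (rule finite_vimageI) (use I finite_subset in auto)
    have sub: "J \<subseteq> {..<Suc (p + q)}" using I by (auto simp: J_def)
    show "I \<in> ?r"
    proof (cases "0 \<in> I")
      case True
      then have "k \<in> I \<longleftrightarrow> k \<in> insert 0 (Suc ` J)" for k by (cases k) (auto simp: J_def)
      then have "I = insert 0 (Suc ` J)" by blast
      moreover have "card J = p" using I fin \<open>I = _\<close> by (simp add: card_image)
      ultimately show ?thesis using sub by auto
    next
      case False
      then have "k \<in> I \<longleftrightarrow> k \<in> Suc ` J" for k by (cases k) (auto simp: J_def)
      then have "I = Suc ` J" by blast
      moreover have "card J = Suc p" using I fin \<open>I = _\<close> by (simp add: card_image)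
      ultimately show ?thesis using sub by auto
    qed
  next
    fix I assume "I \<in> ?r"
    then show "I \<in> ?l"
      by (auto simp: card_image card_insert_if finite_subset[OF _ finite_lessThan])
  qed
  have inj: "inj_on (\<lambda>J. insert 0 (Suc ` J)) X" "inj_on (\<lambda>J. Suc ` J) X" for X
    by (rule inj_on_inverseI[of _ "\<lambda>I. Suc -` I"]; auto)+
  show ?thesis
    unfolding sets by (subst sum.union_disjoint) (auto simp: sum.reindex inj finite_shuffle_sets)
qed

abbreviation degree_tag :: "(int \<Rightarrow> 'a set) \<Rightarrow> 'a list \<Rightarrow> ('a \<times> int) list" where
  "degree_tag V \<equiv> map (\<lambda>a. (a, deg V a))"

lemma word_degree_degree_tag: "word_degree (degree_tag V u) = (\<Sum>a\<leftarrow>u. deg V a)"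
  by (induction u) auto

lemma map_fst_degree_tag [simp]: "map fst (degree_tag V u) = u"
  by (simp add: comp_def)

text \<open>
  Splitting the sets of positions according to whether they contain 0 reproduces the
  recursion of \<open>shuffle_sum\<close>.
\<close>

lemma sum_shuffle_words:
  fixes \<phi> :: "'a list \<Rightarrow> 'c::ab_group_add"
  shows "(\<Sum>I \<in> shuffle_sets (length u) (length v). signed (shuffle_exponent V u v I) (\<phi> (shuffle_word u v I))) =
    shuffle_sum (\<lambda>r. \<phi> (map fst r)) (degree_tag V u) (degree_tag V v)"
proof (induction u arbitrary: \<phi> v)
  case Nil
  have "shuffle_sets 0 (length v) = {{}}" by (auto dest: finite_subset)
  moreover have "shuffle_word [] v {} = v" by (simp add: shuffle_word_def map_nth)
  ultimately show ?case by (simp add: shuffle_exponent_def comp_def)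
next
  case IHu: (Cons a u)
  show ?case
  proof (induction v arbitrary: \<phi>)
    case Nil
    let ?n = "length (a # u)"
    have "I = {..<?n}" if "I \<in> shuffle_sets ?n 0" for I
      by (rule card_subset_eq) (use that in auto)
    then have "shuffle_sets ?n 0 = {{..<?n}}" by (auto simp del: lessThan_Suc)
    moreover have "shuffle_word (a # u) [] {..<?n} = a # u"
      by (rule nth_equalityI) (auto simp: shuffle_word_def Int_absorb1 lessThan_subset_iff[THEN iffD2] simp del: upt_Suc)
    moreover have "shuffle_exponent V (a # u) [] {..<?n} = 0" by (simp add: shuffle_exponent_def)
    ultimately show ?case by (simp add: comp_def del: lessThan_Suc)
  next
    case IHv: (Cons b v)
    have "(\<Sum>J \<in> shuffle_sets (Suc (length u)) (length v).
        signed (deg V b * (\<Sum>a\<leftarrow>a # u. deg V a) + shuffle_exponent V (a # u) v J) (\<phi> (b # shuffle_word (a # u) v J)))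
       = signed (deg V b * (\<Sum>a\<leftarrow>a # u. deg V a)) (\<Sum>J \<in> shuffle_sets (length (a # u)) (length v).
          signed (shuffle_exponent V (a # u) v J) (\<phi> (b # shuffle_word (a # u) v J)))"
      by (simp add: additive.sum[OF additive_signed])
    then show ?case
      unfolding length_Cons sum_shuffle_sets_Cons
      using IHu[where v = "b # v" and \<phi> = "\<lambda>r. \<phi> (a # r)"] IHv[of "\<lambda>r. \<phi> (b # r)"]
      by (simp add: shuffle_exponent_insert shuffle_word_insert shuffle_word_image
          shuffle_exponent_image word_degree_degree_tag)
  qed
qed

section \<open>Operations on words of graded letters\<close>

lemma linear_additive: "Vector_Spaces.linear s s' h \<Longrightarrow> additive h"
  by (auto simp: additive_def Vector_Spaces.linear_def module_hom_def module_hom_axioms_def)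

definition on_words :: "(nat \<Rightarrow> 'a list \<Rightarrow> 'c) \<Rightarrow> ('a \<times> int) list \<Rightarrow> 'c" where
  "on_words \<mu> w = \<mu> (length w) (map fst w)"

definition graded_op :: "(nat \<Rightarrow> 'a list \<Rightarrow> 'a) \<Rightarrow> ('a \<times> int) list \<Rightarrow> 'a \<times> int" where
  "graded_op \<mu> w = (on_words \<mu> w, word_degree w + 1)"

text \<open>
  The pairs whose second component is a valid degree; every degree is valid for the zero vector.
\<close>

definition graded_letters :: "(int \<Rightarrow> 'a set) \<Rightarrow> ('a \<times> int) set" where
  "graded_letters V = {(a, i). a \<in> V i}"

lemma slot_additive_on_words:
  fixes s :: "'k::field \<Rightarrow> 'a::ab_group_add \<Rightarrow> 'a" and s' :: "'k \<Rightarrow> 'c::ab_group_add \<Rightarrow> 'c"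
  assumes "\<And>n. n \<ge> 1 \<Longrightarrow> multilinear s s' n (\<mu> n)"
  shows "slot_additive (on_words \<mu>)"
  unfolding slot_additive_def
proof (intro allI)
  fix p q :: "('a \<times> int) list" and x y :: 'a and i j k
  let ?n = "length p + 1 + length q"
  have "Vector_Spaces.linear s s' (\<lambda>x. \<mu> ?n (map fst p @ [x] @ map fst q))"
    using assms[of ?n] unfolding multilinear_def by simp
  from additive.add[OF linear_additive[OF this], of x y]
  show "on_words \<mu> (p @ (x + y, i) # q) = on_words \<mu> (p @ (x, j) # q) + on_words \<mu> (p @ (y, k) # q)"
    by (simp add: on_words_def)
qed

lemma slot_additive_restrict_length:
  "slot_additive \<phi> \<Longrightarrow> slot_additive (\<lambda>r. if C (length r) then \<phi> r else 0)"
  by (simp add: slot_additive_def)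

lemma degree_tag_homogeneous:
  "(\<forall>a \<in> set as. homogeneous V a) \<longleftrightarrow> set (degree_tag V as) \<subseteq> graded_letters V"
  by (auto simp: graded_letters_def homogeneous_def deg_def intro: someI)

context vector_space
begin

lemma scale_koszul_sign: "scale (koszul_sign e) x = signed e x"
  by (simp add: koszul_sign_def signed_def)

lemma insertion_sum_degree_tag:
  "insertion_sum (graded_op \<mu>) (on_words \<mu>) (degree_tag V as) =
    (\<Sum>k = 1..length as. \<Sum>j = 0..length as - k.
      scale (koszul_sign (\<Sum>a \<leftarrow> take j as. deg V a))
        (\<mu> (length as - k + 1) (take j as @ [\<mu> k (take k (drop j as))] @ drop (j + k) as)))"
  unfolding insertion_sum_eq_sum length_map
proof (intro sum.cong[OF refl])
  fix k j assume "k \<in> {1..length as}" "j \<in> {0..length as - k}"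
  then have "length (take j as) = j" "length (take k (drop j as)) = k" "length (drop (j + k) as) + j = length as - k"
    by auto
  then show "signed (word_degree (take j (degree_tag V as))) (on_words \<mu> (take j (degree_tag V as)
        @ [graded_op \<mu> (take k (drop j (degree_tag V as)))] @ drop (j + k) (degree_tag V as)))
      = scale (koszul_sign (\<Sum>a \<leftarrow> take j as. deg V a))
        (\<mu> (length as - k + 1) (take j as @ [\<mu> k (take k (drop j as))] @ drop (j + k) as))"
    unfolding take_map drop_map word_degree_degree_tag
    by (simp add: scale_koszul_sign on_words_def graded_op_def add.commute comp_def)
qed

lemma eval_formal_superset:
  assumes "finite S" "Poly_Mapping.keys x \<subseteq> S"
  shows "eval_formal scale \<phi> x = (\<Sum>w \<in> S. scale (Poly_Mapping.lookup x w) (\<phi> w))"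
  unfolding eval_formal_def
  by (rule sum.mono_neutral_left) (use assms in \<open>auto simp: in_keys_iff\<close>)

lemma eval_formal_add: "eval_formal scale \<phi> (x + y) = eval_formal scale \<phi> x + eval_formal scale \<phi> y"
proof -
  let ?S = "Poly_Mapping.keys x \<union> Poly_Mapping.keys y"
  have "Poly_Mapping.keys (x + y) \<subseteq> ?S" by (rule Poly_Mapping.keys_add)
  then show ?thesis
    by (simp add: eval_formal_superset[of ?S] lookup_add scale_left_distrib sum.distrib)
qed

lemma eval_formal_scale: "eval_formal scale \<phi> (formal_scale c x) = scale c (eval_formal scale \<phi> x)"
proof -
  have "Poly_Mapping.keys (formal_scale c x) \<subseteq> Poly_Mapping.keys x"
    by (auto simp: in_keys_iff lookup_formal_scale)
  then show ?thesis
    by (simp add: eval_formal_superset[of "Poly_Mapping.keys x"] lookup_formal_scale scale_sum_right)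
qed

lemma eval_formal_single: "eval_formal scale \<phi> (Poly_Mapping.single w c) = scale c (\<phi> w)"
  by (subst eval_formal_superset[of "{w}"]) auto

lemma additive_eval_formal: "additive (eval_formal scale \<phi>)"
  by (simp add: additive_def eval_formal_add)

lemma eval_formal_word_shuffle:
  "eval_formal scale \<phi> (word_shuffle V u v) =
    shuffle_sum (\<lambda>r. \<phi> (map fst r)) (degree_tag V u) (degree_tag V v)"
  unfolding word_shuffle_def sum_shuffle_words[symmetric]
  by (simp add: additive.sum[OF additive_eval_formal] eval_formal_single scale_koszul_sign)

end

context graded_vector_space
begin

lemma deg_eq:
  assumes "a \<in> V i" "a \<noteq> 0"
  shows "deg V a = i"
proof -
  have "a \<in> V (deg V a)" unfolding deg_def using assms(1) by (rule someI)
  moreover have "i = j" if "a \<in> V j" for j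
  proof -
    define c where "c i k = (if k = i then a else 0)" for i k :: int
    have c: "finite {k. c i k \<noteq> 0} \<and> (\<forall>k. c i k \<in> V k) \<and> a = (\<Sum>k | c i k \<noteq> 0. c i k)" if "a \<in> V i" for i
    proof -
      have "{k. c i k \<noteq> 0} = {i}" using assms(2) by (auto simp: c_def)
      then show ?thesis using that subspace_component by (auto simp: c_def subspace_0)
    qed
    have "c i = c j" using direct_sum[of a] c[OF assms(1)] c[OF that] by blast
    then show ?thesis using assms(2) by (metis c_def)
  qed
  ultimately show ?thesis by blast
qed

lemma degree_tag_map_fst:
  assumes "set w \<subseteq> graded_letters V" "\<And>i. (0, i) \<notin> set w"
  shows "degree_tag V (map fst w) = w"
proof -
  have "(fst c, deg V (fst c)) = c" if "c \<in> set w" for c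
  proof (cases c)
    case (Pair a i)
    then show ?thesis using that assms deg_eq[of a i] by (auto simp: graded_letters_def)
  qed
  then show ?thesis by (simp add: map_idI)
qed

text \<open>
  The span consists of formal tensors of all lengths, while \<open>\<psi>\<close> is only meaningful on words of
  length \<open>n\<close>.  Its extension by zero to the other words annihilates every generator, because
  a shuffle product of two words is homogeneous in the length and a tensor relation involves words of
  one length.
\<close>

lemma eval_formal_shuffle_span:
  assumes lin: "multilinear scale scale' n \<psi>" and vs: "vector_space scale'"
    and shuffles: "\<And>u v. u \<noteq> [] \<Longrightarrow> v \<noteq> [] \<Longrightarrow> set u \<subseteq> graded_letters V \<Longrightarrow> set v \<subseteq> graded_letters V \<Longrightarrow>
      length u + length v = n \<Longrightarrow> shuffle_sum (\<lambda>r. \<psi> (map fst r)) u v = 0"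
    and x: "x \<in> formal_tensor_power V n \<inter> shuffle_span scale V"
  shows "eval_formal scale' \<psi> x = 0"
proof -
  interpret W: vector_space scale' by fact
  interpret F: vector_space formal_scale by (rule vector_space_formal_scale)
  define \<phi> where "\<phi> w = (if length w = n then \<psi> w else 0)" for w
  have sub: "F.subspace {y. eval_formal scale' \<phi> y = 0}"
    using additive.zero[OF W.additive_eval_formal]
    by (auto simp: F.subspace_def W.eval_formal_add W.eval_formal_scale)
  have "eval_formal scale' \<phi> y = 0" if "y \<in> tensor_relations scale V" for y
    using that unfolding tensor_relations_def
  proof (induction rule: F.span_induct)
    case (step y)
    have linear: "Vector_Spaces.linear scale scale' (\<lambda>x. \<phi> (u @ [x] @ v))" for u v
    proof (cases "length u + 1 + length v = n")
      case True
      then show ?thesis using lin unfolding multilinear_def \<phi>_def by simp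
    next
      case False
      then show ?thesis unfolding \<phi>_def
        by unfold_locales auto
    qed
    from step show ?case
    proof (elim UnE CollectE exE conjE)
      fix u v a b
      assume "y = Poly_Mapping.single (u @ [a + b] @ v) 1
        - Poly_Mapping.single (u @ [a] @ v) 1 - Poly_Mapping.single (u @ [b] @ v) 1"
      then show ?thesis
        using additive.add[OF linear_additive[OF linear[of u v]], of a b]
        by (simp add: additive.diff[OF W.additive_eval_formal] W.eval_formal_single)
    next
      fix u v a c
      assume "y = Poly_Mapping.single (u @ [scale c a] @ v) 1 - Poly_Mapping.single (u @ [a] @ v) c"
      moreover have "\<phi> (u @ [scale c a] @ v) = scale' c (\<phi> (u @ [a] @ v))"
        using linear[of u v] by (simp add: Vector_Spaces.linear_def module_hom_def module_hom_axioms_def)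
      ultimately show ?thesis
        by (simp add: additive.diff[OF W.additive_eval_formal] W.eval_formal_single)
    qed
  qed (rule sub)
  moreover have "eval_formal scale' \<phi> (shuffle_product V y z) = 0"
    if y: "y \<in> formal_tensors V" and z: "z \<in> formal_tensors V" for y z
  proof -
    have "eval_formal scale' \<phi> (word_shuffle V u v) = 0"
      if u: "u \<in> Poly_Mapping.keys y" and v: "v \<in> Poly_Mapping.keys z" for u v
    proof -
      have *: "u \<noteq> []" "v \<noteq> []" "set (degree_tag V u) \<subseteq> graded_letters V"
        "set (degree_tag V v) \<subseteq> graded_letters V"
        using y z u v by (auto simp only: formal_tensors_def mem_Collect_eq degree_tag_homogeneous[symmetric])
      have "shuffle_sum (\<lambda>r. \<phi> (map fst r)) (degree_tag V u) (degree_tag V v) =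
        shuffle_sum (\<lambda>r. if length u + length v = n then \<psi> (map fst r) else 0) (degree_tag V u) (degree_tag V v)"
        by (rule shuffle_sum_cong) (simp add: \<phi>_def)
      also have "\<dots> = 0"
        using shuffles[of "degree_tag V u" "degree_tag V v"] *
        by (cases "length u + length v = n") (auto simp: shuffle_sum_zero)
      finally show ?thesis by (simp add: W.eval_formal_word_shuffle)
    qed
    then show ?thesis
      by (simp add: shuffle_product_def additive.sum[OF W.additive_eval_formal] W.eval_formal_scale)
  qed
  ultimately have "eval_formal scale' \<phi> x = 0"
    using x unfolding shuffle_span_def
    by (auto intro!: F.span_induct[OF _ sub, of x, simplified])
  moreover have "eval_formal scale' \<phi> x = eval_formal scale' \<psi> x"
    unfolding eval_formal_def
    by (rule sum.cong) (use x in \<open>auto simp: \<phi>_def formal_tensor_power_def\<close>)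
  ultimately show ?thesis by simp
qed

end

context A_infinity_algebra
begin

lemma slot_additive_operations: "slot_additive (on_words m)"
  using m_multilinear by (rule slot_additive_on_words)

text \<open>
  The given relations use the degree function, which agrees with the attached degrees unless some
  letter is zero; in that case every term vanishes.
\<close>

lemma insertion_sum_operations:
  assumes "w \<noteq> []" "set w \<subseteq> graded_letters V"
  shows "insertion_sum (graded_op m) (on_words m) w = 0"
proof (cases "\<exists>i. (0, i) \<in> set w")
  case True
  then show ?thesis
    using insertion_sum_mem_zero[of "on_words m" "graded_op m"]
    by (auto simp: graded_op_def slot_additive_operations)
next
  case False
  have w: "degree_tag V (map fst w) = w" by (rule degree_tag_map_fst) (use assms False in auto)
  have "\<forall>a \<in> set (map fst w). homogeneous V a" unfolding degree_tag_homogeneous w by fact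
  then have "insertion_sum (graded_op m) (on_words m) (degree_tag V (map fst w)) = 0"
    unfolding insertion_sum_degree_tag using assms(1) by (intro A_infinity_relation) (auto simp: Suc_le_eq)
  then show ?thesis unfolding w .
qed

end

lemma (in C_infinity_algebra) shuffle_sum_operations:
  assumes "u \<noteq> []" "v \<noteq> []" "set u \<subseteq> graded_letters V" "set v \<subseteq> graded_letters V"
  shows "shuffle_sum (on_words m) u v = 0"
proof (cases "\<exists>i. (0, i) \<in> set u \<union> set v")
  case True
  then show ?thesis using shuffle_sum_mem_zero[OF slot_additive_operations] by blast
next
  case False
  let ?u = "map fst u" and ?v = "map fst v" and ?n = "length u + length v"
  let ?s = "word_shuffle V ?u ?v :: 'a list \<Rightarrow>\<^sub>0 'k"
  interpret F: vector_space formal_scale by (rule vector_space_formal_scale)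
  have tag: "degree_tag V ?u = u" "degree_tag V ?v = v"
    by (rule degree_tag_map_fst; use assms False in auto)+
  have hom: "\<forall>a \<in> set ?u. homogeneous V a" "\<forall>a \<in> set ?v. homogeneous V a"
    unfolding degree_tag_homogeneous tag by fact+
  have keys: "w \<noteq> [] \<and> (\<forall>a \<in> set w. homogeneous V a) \<and> length w = ?n"
    if w: "w \<in> Poly_Mapping.keys ?s" for w
  proof -
    obtain I where I: "I \<in> shuffle_sets (length ?u) (length ?v)"
      and wI: "w \<in> Poly_Mapping.keys (Poly_Mapping.single (shuffle_word ?u ?v I)
        (koszul_sign (shuffle_exponent V ?u ?v I)) :: 'a list \<Rightarrow>\<^sub>0 'k)"
      using subsetD[OF keys_sum w[unfolded word_shuffle_def]] by blast
    then have w: "w = shuffle_word ?u ?v I" by (auto split: if_splits)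
    have "set w \<subseteq> set ?u \<union> set ?v" unfolding w by (rule set_shuffle_word) fact
    moreover have "length w = ?n" by (simp add: w)
    ultimately show ?thesis using hom assms(1) by auto
  qed
  have "?s \<in> formal_tensor_power V ?n"
    using keys by (auto simp: formal_tensor_power_def formal_tensors_def)
  moreover have "?s \<in> shuffle_span scale V"
  proof -
    define x y :: "'a list \<Rightarrow>\<^sub>0 'k"
      where "x = Poly_Mapping.single ?u 1" and "y = Poly_Mapping.single ?v 1"
    have "x \<in> formal_tensors V" "y \<in> formal_tensors V"
      using hom assms by (auto simp: x_def y_def formal_tensors_def)
    moreover have "?s = shuffle_product V x y"
      by (simp add: shuffle_product_def x_def y_def)
    ultimately show ?thesis unfolding shuffle_span_def by (blast intro: F.span_base)
  qed
  ultimately have "eval_formal scale (m ?n) ?s = 0"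
    using assms(1,2) by (intro vanishes_on_shuffles) (cases u; cases v; auto)+
  then have "shuffle_sum (\<lambda>r. m ?n (map fst r)) u v = 0"
    unfolding eval_formal_word_shuffle tag .
  moreover have "shuffle_sum (on_words m) u v = shuffle_sum (\<lambda>r. m ?n (map fst r)) u v"
    by (rule shuffle_sum_cong) (simp add: on_words_def)
  ultimately show ?thesis by simp
qed

section \<open>Sums over trees\<close>

locale transfer =
  A: A_infinity_algebra scaleA VA dA mA + contraction scaleA VA dA scaleB VB dB f g H
  for scaleA :: "'k::field \<Rightarrow> 'a::ab_group_add \<Rightarrow> 'a" and VA dA mA
    and scaleB :: "'k \<Rightarrow> 'b::ab_group_add \<Rightarrow> 'b" and VB dB f g H
begin

abbreviation mB :: "nat \<Rightarrow> 'b list \<Rightarrow> 'b" where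
  "mB \<equiv> transferred mA dB f g H"

definition tree_sum :: "('b \<times> int) list \<Rightarrow> 'a \<times> int" where
  "tree_sum w = (\<Sum>T \<in> planar_trees (length w). subtree_map mA g H T (map fst w), word_degree w)"

definition higher_operation :: "('a \<times> int) list \<Rightarrow> 'a" where
  "higher_operation r = (if length r \<ge> 2 then on_words mA r else 0)"

abbreviation vertex_sum :: "('b \<times> int) list \<Rightarrow> 'a" where
  "vertex_sum \<equiv> block_sum tree_sum higher_operation"

lemmas f_additive = linear_additive[OF f_linear]
lemmas g_additive = linear_additive[OF g_linear]
lemmas H_additive = linear_additive[OF H_linear]
lemmas dA_additive = linear_additive[OF A.d_linear]
lemmas dB_additive = linear_additive[OF B.d_linear]

lemma snd_tree_sum [simp]: "snd (tree_sum w) = word_degree w"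
  by (simp add: tree_sum_def)

lemma slot_additive_higher_operation: "slot_additive higher_operation"
  using slot_additive_restrict_length[OF A.slot_additive_operations, of "\<lambda>n. n \<ge> 2"]
  by (simp add: higher_operation_def[abs_def])

lemma higher_operation_single [simp]: "higher_operation [c] = 0"
  by (simp add: higher_operation_def)

lemma vertex_sum_eq_sum:
  "vertex_sum w = (\<Sum>ts \<in> planar_forests (length w).
    if length ts \<ge> 2 then mA (length ts) (forest_map mA g H ts (map fst w)) else 0)"
  by (subst sum_forests_eq_block_sum[OF slot_additive_higher_operation,
      where m = mA and g = g and H = H and k = word_degree])
    (auto simp: tree_sum_def higher_operation_def on_words_def comp_def intro!: sum.cong)

lemma vertex_sum_single: "length w = 1 \<Longrightarrow> vertex_sum w = 0"
  by (cases w) auto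

text \<open>
  A tree is either a tail, giving \<open>g\<close>, or has a lowest vertex, below which there is an edge
  labelled \<open>H\<close>.
\<close>

lemma fst_tree_sum: "fst (tree_sum w) = (if length w = 1 then g (fst (hd w)) else 0) + H (vertex_sum w)"
proof -
  have "H (vertex_sum w) = (\<Sum>ts \<in> planar_forests (length w).
    if length ts \<ge> 2 then subtree_map mA g H (Vertex ts) (map fst w) else 0)"
    unfolding vertex_sum_eq_sum additive.sum[OF H_additive]
    by (rule sum.cong) (auto simp: additive.zero[OF H_additive])
  then show ?thesis
    unfolding tree_sum_def fst_conv sum_planar_trees by (cases "w = []") (simp_all add: hd_map)
qed

lemma mB_eq:
  "on_words mB w = (if length w = 1 then dB (fst (hd w)) else 0) + f (vertex_sum w)"
proof (cases "length w = 1")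
  case True
  then have "vertex_sum w = 0" by (rule vertex_sum_single)
  with True show ?thesis
    by (cases w) (auto simp: on_words_def transferred_def additive.zero[OF f_additive])
next
  case False
  have "f (vertex_sum w) = (\<Sum>ts \<in> planar_forests (length w).
    if length ts \<ge> 2 then tree_operation mA f g H (Vertex ts) (map fst w) else 0)"
    unfolding vertex_sum_eq_sum additive.sum[OF f_additive]
    by (rule sum.cong) (auto simp: additive.zero[OF f_additive])
  with False show ?thesis by (simp add: on_words_def transferred_def sum_planar_trees)
qed

section \<open>Multilinearity and degrees of the transferred operations\<close>

text \<open>
  The varied argument passes through exactly one tree of the forest.
\<close>

lemma forest_map_slot:
  assumes "\<And>t us vs. t \<in> set ts \<Longrightarrow> length us + 1 + length vs = num_tails t \<Longrightarrow>
      Vector_Spaces.linear scaleB scaleA (\<lambda>x. subtree_map mA g H t (us @ [x] @ vs))"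
    and "length us + 1 + length vs = (\<Sum>t\<leftarrow>ts. num_tails t)"
  shows "\<exists>p s h. Vector_Spaces.linear scaleB scaleA h \<and> length p + 1 + length s = length ts \<and>
    (\<forall>x. forest_map mA g H ts (us @ [x] @ vs) = p @ [h x] @ s)"
  using assms
proof (induction ts arbitrary: us)
  case (Cons t ts)
  show ?case
  proof (cases "length us < num_tails t")
    case True
    define k where "k = num_tails t - length us - 1"
    let ?h = "\<lambda>x. subtree_map mA g H t (us @ [x] @ take k vs)"
    have k: "num_tails t = length us + 1 + k" "k \<le> length vs" using True Cons.prems(2) by (auto simp: k_def)
    then have "Vector_Spaces.linear scaleB scaleA ?h" by (intro Cons.prems(1)) auto
    moreover have "forest_map mA g H (t # ts) (us @ [x] @ vs) = [] @ [?h x] @ forest_map mA g H ts (drop k vs)" for x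
      using k by simp
    ultimately show ?thesis
      by (intro exI[of _ "[]"] exI[of _ "forest_map mA g H ts (drop k vs)"] exI[of _ ?h]) auto
  next
    case False
    let ?us = "drop (num_tails t) us"
    have "length ?us + 1 + length vs = (\<Sum>t\<leftarrow>ts. num_tails t)" using False Cons.prems(2) by auto
    then obtain p s h where *: "Vector_Spaces.linear scaleB scaleA h" "length p + 1 + length s = length ts"
      "\<And>x. forest_map mA g H ts (?us @ [x] @ vs) = p @ [h x] @ s"
      using Cons.IH[of ?us] Cons.prems(1) by auto
    let ?p = "subtree_map mA g H t (take (num_tails t) us) # p"
    have "forest_map mA g H (t # ts) (us @ [x] @ vs) = ?p @ [h x] @ s" for x
      using False *(3)[of x] by simp
    then show ?thesis using * by (intro exI[of _ ?p] exI[of _ s] exI[of _ h]) auto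
  qed
qed simp

lemma vertex_linear:
  assumes "\<And>t us vs. t \<in> set ts \<Longrightarrow> length us + 1 + length vs = num_tails t \<Longrightarrow>
      Vector_Spaces.linear scaleB scaleA (\<lambda>x. subtree_map mA g H t (us @ [x] @ vs))"
    and "length us + 1 + length vs = (\<Sum>t\<leftarrow>ts. num_tails t)"
  shows "Vector_Spaces.linear scaleB scaleA
    (\<lambda>x. mA (length ts) (forest_map mA g H ts (us @ [x] @ vs)))"
proof -
  obtain p s h where h: "Vector_Spaces.linear scaleB scaleA h" and len: "length p + 1 + length s = length ts"
    and eq: "\<And>x. forest_map mA g H ts (us @ [x] @ vs) = p @ [h x] @ s"
    using forest_map_slot[OF assms] by blast
  have "Vector_Spaces.linear scaleA scaleA (\<lambda>x. mA (length ts) (p @ [x] @ s))"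
    using A.m_multilinear[of "length ts"] len unfolding multilinear_def by simp
  from Vector_Spaces.linear_compose[OF h this] show ?thesis unfolding eq by (simp add: comp_def)
qed

lemma subtree_map_linear:
  "length us + 1 + length vs = num_tails T \<Longrightarrow>
    Vector_Spaces.linear scaleB scaleA (\<lambda>x. subtree_map mA g H T (us @ [x] @ vs))"
proof (induction T arbitrary: us vs)
  case Tail
  then show ?case using g_linear by simp
next
  case (Vertex ts)
  have "Vector_Spaces.linear scaleB scaleA (\<lambda>x. mA (length ts) (forest_map mA g H ts (us @ [x] @ vs)))"
    by (rule vertex_linear) (use Vertex in auto)
  from Vector_Spaces.linear_compose[OF this H_linear] show ?case by (simp add: comp_def)
qed

lemma mB_multilinear:
  assumes "n \<ge> 1"
  shows "multilinear scaleB scaleB n (mB n)"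
  unfolding multilinear_def
proof (intro allI impI)
  fix us vs :: "'b list" assume len: "length us + 1 + length vs = n"
  show "Vector_Spaces.linear scaleB scaleB (\<lambda>x. mB n (us @ [x] @ vs))"
  proof (cases "n = 1")
    case True
    then show ?thesis using len B.d_linear by (simp add: transferred_def)
  next
    case False
    interpret BB: vector_space_pair scaleB scaleB by unfold_locales
    have "Vector_Spaces.linear scaleB scaleB (\<lambda>x. tree_operation mA f g H T (us @ [x] @ vs))"
      if T: "T \<in> planar_trees n" for T
    proof (cases T)
      case (Vertex ts)
      have "Vector_Spaces.linear scaleB scaleA (\<lambda>x. mA (length ts) (forest_map mA g H ts (us @ [x] @ vs)))"
        by (rule vertex_linear[OF subtree_map_linear]) (use T Vertex len in \<open>auto simp: planar_trees_def\<close>)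
      from Vector_Spaces.linear_compose[OF this f_linear] show ?thesis by (simp add: Vertex comp_def)
    qed (use T False in \<open>auto simp: planar_trees_def\<close>)
    then show ?thesis using False by (simp add: transferred_def BB.linear_compose_sum)
  qed
qed

lemma forest_map_degree:
  assumes "\<And>t bs is. t \<in> set ts \<Longrightarrow> length bs = num_tails t \<Longrightarrow> list_all2 (\<lambda>b i. b \<in> VB i) bs is \<Longrightarrow>
      subtree_map mA g H t bs \<in> VA (sum_list is)"
    and "length bs = (\<Sum>t\<leftarrow>ts. num_tails t)" "list_all2 (\<lambda>b i. b \<in> VB i) bs is"
  shows "\<exists>js. list_all2 (\<lambda>a i. a \<in> VA i) (forest_map mA g H ts bs) js \<and> sum_list js = sum_list is"
  using assms
proof (induction ts arbitrary: bs "is")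
  case (Cons t ts)
  let ?n = "num_tails t"
  obtain js where js: "list_all2 (\<lambda>a i. a \<in> VA i) (forest_map mA g H ts (drop ?n bs)) js"
    "sum_list js = sum_list (drop ?n is)"
    using Cons.IH[of "drop ?n bs" "drop ?n is"] Cons.prems by auto
  have "subtree_map mA g H t (take ?n bs) \<in> VA (sum_list (take ?n is))"
    using Cons.prems by (intro Cons.prems(1)) auto
  moreover have "sum_list (take ?n is) + sum_list (drop ?n is) = sum_list is"
    by (metis append_take_drop_id sum_list_append)
  ultimately show ?case using js by (intro exI[of _ "sum_list (take ?n is) # js"]) auto
qed auto

lemma vertex_degree:
  assumes "\<And>t bs is. t \<in> set ts \<Longrightarrow> length bs = num_tails t \<Longrightarrow> list_all2 (\<lambda>b i. b \<in> VB i) bs is \<Longrightarrow>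
      subtree_map mA g H t bs \<in> VA (sum_list is)"
    and "length bs = (\<Sum>t\<leftarrow>ts. num_tails t)" "list_all2 (\<lambda>b i. b \<in> VB i) bs is" "length ts \<ge> 1"
  shows "mA (length ts) (forest_map mA g H ts bs) \<in> VA (sum_list is + 1)"
proof -
  obtain js where "list_all2 (\<lambda>a i. a \<in> VA i) (forest_map mA g H ts bs) js" "sum_list js = sum_list is"
    using forest_map_degree[OF assms(1-3)] by blast
  then show ?thesis using A.m_degree[of "length ts"] assms(4) unfolding has_multidegree_def
    by (metis length_forest_map)
qed

lemma subtree_map_degree:
  "reduced T \<Longrightarrow> length bs = num_tails T \<Longrightarrow> list_all2 (\<lambda>b i. b \<in> VB i) bs is \<Longrightarrow>
    subtree_map mA g H T bs \<in> VA (sum_list is)"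
proof (induction T arbitrary: bs "is")
  case Tail
  then obtain b i where "bs = [b]" "is = [i]" "b \<in> VB i"
    by (auto simp: length_Suc_conv list_all2_Cons1)
  then show ?case using g_degree by (auto simp: has_degree_def)
next
  case (Vertex ts)
  have "mA (length ts) (forest_map mA g H ts bs) \<in> VA (sum_list is + 1)"
    by (rule vertex_degree) (use Vertex in auto)
  then have "H (mA (length ts) (forest_map mA g H ts bs)) \<in> VA (sum_list is + 1 + - 1)"
    using H_degree unfolding has_degree_def by blast
  then show ?case by simp
qed

lemma tree_sum_graded:
  assumes "set w \<subseteq> graded_letters VB"
  shows "tree_sum w \<in> graded_letters VA"
proof -
  have w: "list_all2 (\<lambda>b i. b \<in> VB i) (map fst w) (map snd w)"
    using assms by (auto simp: list_all2_conv_all_nth graded_letters_def dest!: nth_mem)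
  have "(\<Sum>T \<in> planar_trees (length w). subtree_map mA g H T (map fst w)) \<in> VA (sum_list (map snd w))"
    by (intro A.subspace_sum[OF A.subspace_component] subtree_map_degree)
      (use w in \<open>auto simp: planar_trees_def\<close>)
  then show ?thesis by (simp add: tree_sum_def graded_letters_def word_degree_def)
qed

lemma mB_degree:
  assumes "n \<ge> 1"
  shows "has_multidegree VB VB n 1 (mB n)"
  unfolding has_multidegree_def
proof (intro allI impI, elim conjE)
  fix bs "is" assume bs: "length bs = n" "list_all2 (\<lambda>b i. b \<in> VB i) bs is"
  show "mB n bs \<in> VB (sum_list is + 1)"
  proof (cases "n = 1")
    case True
    then obtain b i where "bs = [b]" "is = [i]" "b \<in> VB i"
      using bs by (auto simp: length_Suc_conv list_all2_Cons1)
    then show ?thesis using B.d_degree True by (auto simp: transferred_def has_degree_def)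
  next
    case False
    have "tree_operation mA f g H T bs \<in> VB (sum_list is + 1)" if T: "T \<in> planar_trees n" for T
    proof (cases T)
      case (Vertex ts)
      have "mA (length ts) (forest_map mA g H ts bs) \<in> VA (sum_list is + 1)"
        by (rule vertex_degree[OF subtree_map_degree]) (use T Vertex bs in \<open>auto simp: planar_trees_def\<close>)
      then have "f (mA (length ts) (forest_map mA g H ts bs)) \<in> VB (sum_list is + 1 + 0)"
        using f_degree unfolding has_degree_def by blast
      then show ?thesis by (simp add: Vertex)
    qed (use T False in \<open>auto simp: planar_trees_def\<close>)
    then show ?thesis using False
      by (simp add: transferred_def B.subspace_sum[OF B.subspace_component])
  qed
qed

section \<open>The transferred relations\<close>

lemma set_blocks_graded:
  assumes "\<And>c. c \<in> set r \<Longrightarrow> \<exists>x. x \<noteq> [] \<and> set x \<subseteq> set w \<and> c = tree_sum x"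
    and "set w \<subseteq> graded_letters VB"
  shows "set r \<subseteq> graded_letters VA"
  using assms tree_sum_graded by blast

text \<open>
  With empty context both sides are values on words of length one, hence zero.
\<close>

lemma higher_operation_context_cong:
  assumes "p \<noteq> [] \<or> s \<noteq> [] \<Longrightarrow> fst c = fst c'"
  shows "higher_operation (p @ c # s) = higher_operation (p @ c' # s)"
proof (cases "p = [] \<and> s = []")
  case False
  then show ?thesis
    using assms slot_additive_degree[OF slot_additive_higher_operation, of p "fst c" "snd c" s "snd c'"]
    by (cases c; cases c') auto
qed simp

text \<open>
  The cut into one block contributes \<open>d\<^sub>A G\<close>, all others contribute to \<open>P\<close>.
\<close>

lemma block_sum_operations:
  assumes "w \<noteq> []"
  shows "block_sum tree_sum (on_words mA) w = dA (fst (tree_sum w)) + vertex_sum w"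
proof -
  have "block_sum tree_sum (on_words mA) w =
      block_sum tree_sum (\<lambda>r. (if length r = 1 then dA (fst (hd r)) else 0) + higher_operation r) w"
  proof (rule block_sum_cong)
    fix r :: "('a \<times> int) list" assume "(r = []) = (w = [])"
    then have "r \<noteq> []" using assms by simp
    then show "on_words mA r = (if length r = 1 then dA (fst (hd r)) else 0) + higher_operation r"
      using A.m_1 by (cases r; cases "tl r") (auto simp: on_words_def higher_operation_def)
  qed
  then show ?thesis
    using block_sum_single[OF assms, of tree_sum "\<lambda>c. dA (fst c)"] by (simp add: block_sum_add)
qed

text \<open>
  The relation for a word uses the morphism equation for its proper pieces, and the morphism equation
  for a word uses the relation for the same word, so the two are proved in one induction.
\<close>

lemma
  assumes "w \<noteq> []" "set w \<subseteq> graded_letters VB"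
  shows vertex_sum_relation: "dA (vertex_sum w) + insertion_sum (graded_op mB) vertex_sum w = 0"
    and tree_sum_morphism: "dA (fst (tree_sum w)) + vertex_sum w =
      insertion_sum (graded_op mB) (\<lambda>r. fst (tree_sum r)) w"
proof -
  have "dA (vertex_sum w) + insertion_sum (graded_op mB) vertex_sum w = 0 \<and>
    dA (fst (tree_sum w)) + vertex_sum w = insertion_sum (graded_op mB) (\<lambda>r. fst (tree_sum r)) w"
    using assms
  proof (induction "length w" arbitrary: w rule: less_induct)
    case less
    let ?K = "\<lambda>x. (block_sum tree_sum (\<lambda>r. fst (graded_op mA r)) x, 0)"
    let ?R = "insertion_sum (graded_op mB) (\<lambda>r. fst (tree_sum r))"
    have K: "fst (?K x) = dA (fst (tree_sum x)) + vertex_sum x" if "x \<noteq> []" for x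
      using block_sum_operations[OF that] by (simp add: graded_op_def)
    \<comment> \<open>The relations of \<open>A\<close> on the image of the coalgebra morphism; the block with \<open>?K\<close>, which
      is \<open>d\<^sub>A G + P\<close>, either is the whole word or is shorter.  Its second component is a dummy degree.\<close>
    have "0 = block_sum tree_sum (\<lambda>r. 0) w"
      by (simp add: additive_functional_zero[OF additive_functional_block_sum])
    also have "\<dots> = block_sum tree_sum (insertion_sum (graded_op mA) (on_words mA)) w"
    proof (rule block_sum_cong)
      fix r :: "('a \<times> int) list"
      assume r: "(r = []) = (w = [])" "\<And>c. c \<in> set r \<Longrightarrow> \<exists>x. x \<noteq> [] \<and> set x \<subseteq> set w \<and> c = tree_sum x"
      from r(2) less.prems(2) have "set r \<subseteq> graded_letters VA" by (rule set_blocks_graded)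
      then show "0 = insertion_sum (graded_op mA) (on_words mA) r"
        using r(1) less.prems(1) by (simp add: A.insertion_sum_operations)
    qed
    also have "\<dots> = block_insertion_sum tree_sum ?K (on_words mA) w"
      by (rule block_sum_insertion_sum) (simp_all add: A.slot_additive_operations)
    also have "\<dots> = block_insertion_sum tree_sum ?K
        (\<lambda>r. (if length r = 1 then dA (fst (hd r)) else 0) + higher_operation r) w"
    proof (rule block_insertion_sum_cong)
      fix p s :: "('a \<times> int) list" and x :: "('b \<times> int) list"
      show "on_words mA (p @ ?K x # s) = (if length (p @ ?K x # s) = 1 then dA (fst (hd (p @ ?K x # s))) else 0)
          + higher_operation (p @ ?K x # s)"
        using A.m_1 by (cases p; cases s) (auto simp: on_words_def higher_operation_def)
    qed
    also have "\<dots> = dA (fst (?K w)) + block_insertion_sum tree_sum ?K higher_operation w"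
      unfolding block_insertion_sum_add
      using block_insertion_sum_single[OF less.prems(1), of tree_sum ?K "\<lambda>c. dA (fst c)"] by simp
    also have "dA (fst (?K w)) = dA (vertex_sum w)"
      unfolding K[OF less.prems(1)] by (simp add: additive.add[OF dA_additive] A.d_square)
    also have "block_insertion_sum tree_sum ?K higher_operation w =
        block_insertion_sum tree_sum (\<lambda>x. (?R x, 0)) higher_operation w"
    proof (rule block_insertion_sum_cong)
      fix p s :: "('a \<times> int) list" and x :: "('b \<times> int) list"
      assume x: "x \<noteq> []" "set x \<subseteq> set w" "length p + length x + length s \<le> length w"
      show "higher_operation (p @ ?K x # s) = higher_operation (p @ (?R x, 0) # s)"
      proof (rule higher_operation_context_cong)
        assume "p \<noteq> [] \<or> s \<noteq> []"
        then have "length x < length w" using x(3) by (cases p; cases s) auto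
        then have "dA (fst (tree_sum x)) + vertex_sum x = ?R x" using less x by auto
        then show "fst (?K x) = fst (?R x, 0)" using K[OF x(1)] by simp
      qed
    qed
    also have "\<dots> = insertion_sum (graded_op mB) vertex_sum w"
      by (rule insertion_sum_block_sum[symmetric]) (rule slot_additive_higher_operation)
    finally have rel: "dA (vertex_sum w) + insertion_sum (graded_op mB) vertex_sum w = 0" by simp
    have "?R w = insertion_sum (graded_op mB)
        (\<lambda>r. (if length r = 1 then g (fst (hd r)) else 0) + H (vertex_sum r)) w"
      by (simp add: fst_tree_sum)
    also have "\<dots> = g (on_words mB w) + H (insertion_sum (graded_op mB) vertex_sum w)"
      using insertion_sum_single[OF less.prems(1), of "graded_op mB" "\<lambda>c. g (fst c)"]
      by (simp add: insertion_sum_add insertion_sum_additive[OF H_additive] graded_op_def)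
    also have "insertion_sum (graded_op mB) vertex_sum w = - dA (vertex_sum w)"
      using rel by (simp add: eq_neg_iff_add_eq_0 add.commute)
    also have "g (on_words mB w) = (if length w = 1 then g (dB (fst (hd w))) else 0) + g (f (vertex_sum w))"
      by (simp add: mB_eq additive.add[OF g_additive] additive.zero[OF g_additive])
    also have "g (f (vertex_sum w)) = vertex_sum w + dA (H (vertex_sum w)) + H (dA (vertex_sum w))"
      using homotopy[of "vertex_sum w"] by (simp add: algebra_simps)
    finally have "?R w = dA (fst (tree_sum w)) + vertex_sum w"
      by (simp add: fst_tree_sum additive.minus[OF H_additive] additive.add[OF dA_additive]
          additive.zero[OF dA_additive] g_cochain A.d_square)
    with rel show ?case by simp
  qed
  then show "dA (vertex_sum w) + insertion_sum (graded_op mB) vertex_sum w = 0"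
    "dA (fst (tree_sum w)) + vertex_sum w = insertion_sum (graded_op mB) (\<lambda>r. fst (tree_sum r)) w" by auto
qed

text \<open>
  Apply \<open>f\<close> to \<open>vertex_sum_relation\<close>, and use that \<open>f\<close> is a cochain map.
\<close>

lemma mB_relation:
  assumes "w \<noteq> []" "set w \<subseteq> graded_letters VB"
  shows "insertion_sum (graded_op mB) (on_words mB) w = 0"
proof -
  have "on_words mB = (\<lambda>r. (if length r = 1 then dB (fst (hd r)) else 0) + f (vertex_sum r))"
    by (simp add: mB_eq fun_eq_iff)
  then have "insertion_sum (graded_op mB) (on_words mB) w
      = insertion_sum (graded_op mB) (\<lambda>r. (if length r = 1 then dB (fst (hd r)) else 0) + f (vertex_sum r)) w"
    by simp
  also have "\<dots> = dB (on_words mB w) + f (insertion_sum (graded_op mB) vertex_sum w)"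
    using insertion_sum_single[OF assms(1), of "graded_op mB" "\<lambda>c. dB (fst c)"]
    by (simp add: insertion_sum_add insertion_sum_additive[OF f_additive] graded_op_def)
  also have "dB (on_words mB w) = f (dA (vertex_sum w))"
    by (simp add: mB_eq additive.add[OF dB_additive] B.d_square f_cochain additive.zero[OF dB_additive])
  finally show ?thesis
    using vertex_sum_relation[OF assms]
    by (simp add: additive.zero[OF f_additive] flip: additive.add[OF f_additive])
qed

lemma A_infinity_transferred: "A_infinity_algebra scaleB VB dB mB"
proof
  show "mB 1 [x] = dB x" for x by (simp add: transferred_def)
next
  fix n :: nat and as :: "'b list"
  assume as: "n \<ge> 1" "length as = n" "\<forall>a \<in> set as. homogeneous VB a"
  then have "degree_tag VB as \<noteq> []" by auto
  then show "(\<Sum>k = 1..n. \<Sum>j = 0..n - k.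
          scaleB (koszul_sign (\<Sum>a \<leftarrow> take j as. deg VB a))
            (mB (n - k + 1) (take j as @ [mB k (take k (drop j as))] @ drop (j + k) as))) = 0"
    using mB_relation[of "degree_tag VB as"] as
    unfolding degree_tag_homogeneous B.insertion_sum_degree_tag by blast
qed (simp_all add: mB_multilinear mB_degree)

section \<open>Vanishing on shuffles\<close>

text \<open>
  By induction \<open>tree_sum = H P\<close> annihilates shorter shuffles, so that the coalgebra morphism of \<open>tree_sum\<close>
  is multiplicative on \<open>u\<close> and \<open>v\<close> as seen by operations of valence at least two.  Its values on
  both words are nonempty, hence the shuffles of them have length at least two and are annihilated by
  the \<open>C\<^sub>\<infinity>\<close>-operations of \<open>A\<close>.
\<close>

lemma vertex_sum_shuffle:
  assumes A: "C_infinity_algebra scaleA VA dA mA"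
    and "u \<noteq> []" "v \<noteq> []" "set u \<subseteq> graded_letters VB" "set v \<subseteq> graded_letters VB"
  shows "shuffle_sum vertex_sum u v = 0"
  using assms(2-)
proof (induction "length u + length v" arbitrary: u v rule: less_induct)
  case less
  have "shuffle_sum vertex_sum u v =
      block_sum tree_sum (\<lambda>U. block_sum tree_sum (\<lambda>V. shuffle_sum higher_operation U V) v) u"
  proof (rule shuffle_sum_block_sum)
    fix p s :: "('a \<times> int) list" and x y :: "('b \<times> int) list"
    assume x: "x \<noteq> []" "y \<noteq> []" "set x \<subseteq> set u" "set y \<subseteq> set v"
      and len: "length p + length x + length y + length s \<le> length u + length v"
    \<comment> \<open>A word of length at least two has no tail term, so \<open>tree_sum\<close> is \<open>H P\<close> on shuffles of
      nonempty words.\<close>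
    show "shuffle_sum (\<lambda>z. higher_operation (p @ tree_sum z # s)) x y = 0"
    proof (cases "p = [] \<and> s = []")
      case True
      then show ?thesis by (simp add: shuffle_sum_zero)
    next
      case False
      then have "length x + length y < length u + length v" using len by (cases p; cases s) auto
      then have 0: "shuffle_sum vertex_sum x y = 0" using less x by blast
      have "shuffle_sum (\<lambda>z. higher_operation (p @ tree_sum z # s)) x y =
          shuffle_sum (\<lambda>z. higher_operation (p @ (H (vertex_sum z), 0) # s)) x y"
      proof (rule shuffle_sum_cong)
        fix z :: "('b \<times> int) list" assume "length z = length x + length y"
        then have "length z \<noteq> 1" using x by (cases x; cases y) auto
        then show "higher_operation (p @ tree_sum z # s) = higher_operation (p @ (H (vertex_sum z), 0) # s)"
          by (intro higher_operation_context_cong) (simp add: fst_tree_sum)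
      qed
      also have "\<dots> = higher_operation (p @ (H (shuffle_sum vertex_sum x y), 0) # s)"
        by (simp add: shuffle_sum_additive[OF slot_additive_additive[OF slot_additive_higher_operation]]
          shuffle_sum_additive[OF H_additive])
      finally show ?thesis
        by (simp add: 0 additive.zero[OF H_additive] slot_additive_zero[OF slot_additive_higher_operation])
    qed
  qed simp
  also have "\<dots> = block_sum tree_sum (\<lambda>U. block_sum tree_sum (\<lambda>V. 0) v) u"
  proof (intro block_sum_cong)
    fix U V :: "('a \<times> int) list"
    assume U: "(U = []) = (u = [])" "\<And>c. c \<in> set U \<Longrightarrow> \<exists>x. x \<noteq> [] \<and> set x \<subseteq> set u \<and> c = tree_sum x"
      and V: "(V = []) = (v = [])" "\<And>c. c \<in> set V \<Longrightarrow> \<exists>x. x \<noteq> [] \<and> set x \<subseteq> set v \<and> c = tree_sum x"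
    have "shuffle_sum higher_operation U V = shuffle_sum (on_words mA) U V"
    proof (rule shuffle_sum_cong)
      fix r :: "('a \<times> int) list" assume "length r = length U + length V"
      then have "length r \<ge> 2" using U(1) V(1) less.prems by (cases U; cases V) auto
      then show "higher_operation r = on_words mA r" by (simp add: higher_operation_def)
    qed
    also have "\<dots> = 0"
      using U(1) V(1) less.prems set_blocks_graded[OF U(2)] set_blocks_graded[OF V(2)]
      by (intro C_infinity_algebra.shuffle_sum_operations[OF A]) auto
    finally show "shuffle_sum higher_operation U V = 0" .
  qed
  finally show ?case by (simp add: additive_functional_zero[OF additive_functional_block_sum])
qed

lemma C_infinity_transferred:
  assumes "C_infinity_algebra scaleA VA dA mA"
  shows "C_infinity_algebra scaleB VB dB mB"
proof -
  interpret T: A_infinity_algebra scaleB VB dB mB by (rule A_infinity_transferred)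
  show ?thesis
  proof
    fix n :: nat and x assume n: "n > 1" and x: "x \<in> formal_tensor_power VB n \<inter> shuffle_span scaleB VB"
    show "eval_formal scaleB (mB n) x = 0"
    proof (rule B.eval_formal_shuffle_span[OF mB_multilinear B.vector_space_axioms _ x])
      fix u v :: "('b \<times> int) list"
      assume uv: "u \<noteq> []" "v \<noteq> []" "set u \<subseteq> graded_letters VB" "set v \<subseteq> graded_letters VB"
        "length u + length v = n"
      have "shuffle_sum (\<lambda>r. mB n (map fst r)) u v = shuffle_sum (\<lambda>r. f (vertex_sum r)) u v"
      proof (rule shuffle_sum_cong)
        fix r :: "('b \<times> int) list" assume "length r = length u + length v"
        then show "mB n (map fst r) = f (vertex_sum r)" using n uv(5) mB_eq[of r] by (auto simp: on_words_def)
      qed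
      also have "\<dots> = 0"
        using vertex_sum_shuffle[OF assms uv(1-4)]
        by (simp add: shuffle_sum_additive[OF f_additive] additive.zero[OF f_additive])
      finally show "shuffle_sum (\<lambda>r. mB n (map fst r)) u v = 0" .
    qed (use n in simp)
  qed
qed

end

theorem theorem12:
  fixes scaleA :: "'k::field_char_0 \<Rightarrow> 'a::ab_group_add \<Rightarrow> 'a"
    and scaleB :: "'k \<Rightarrow> 'b::ab_group_add \<Rightarrow> 'b"
    and VA :: "int \<Rightarrow> 'a set" and VB :: "int \<Rightarrow> 'b set"
    and dA :: "'a \<Rightarrow> 'a" and dB :: "'b \<Rightarrow> 'b"
    and mA :: "nat \<Rightarrow> 'a list \<Rightarrow> 'a"
    and f :: "'a \<Rightarrow> 'b" and g :: "'b \<Rightarrow> 'a" and H :: "'a \<Rightarrow> 'a"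
  assumes "C_infinity_algebra scaleA VA dA mA"
    and "cochain_complex scaleB VB dB"
    and "contraction scaleA VA dA scaleB VB dB f g H"
  shows "C_infinity_algebra scaleB VB dB (transferred mA dB f g H)"
proof -
  interpret A: C_infinity_algebra scaleA VA dA mA by fact
  interpret contraction scaleA VA dA scaleB VB dB f g H by fact
  interpret transfer scaleA VA dA mA scaleB VB dB f g H by unfold_locales
  show ?thesis by (rule C_infinity_transferred) fact
qed

end
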